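(* Let $a,b\in\mathbb Z_{>0}$. The function (theta-quark) $$\theta_{a,b}(\tau,z)=\frac{\vartheta(\tau,az)\vartheta(\tau,bz)\vartheta(\tau,(a+b)z)}{\eta(\tau)}\in J_{1,A_1;a^2+ab+b^2}(v_\eta^8)$$ is a holomorphic Jacobi form of Eichler–Zagier type of weight $1$, index $a^2+ab+b^2$ and character $v_\eta^8$. It is a Jacobi cusp form if $a\not\equiv b\bmod3$.
   Context: $\eta$ is the Dedekind eta function, with multiplier system $v_\eta$: $\eta(\frac{\alpha\tau+\beta}{\gamma\tau+\delta})=v_\eta(A)(\gamma\tau+\delta)^{1/2}\eta(\tau)$ for $A=\begin{pmatrix}\alpha&\beta\\\gamma&\delta\end{pmatrix}\in\mathrm{SL}_2(\mathbb Z)$. $\vartheta(\tau,z)=\sum_{n\in\mathbb Z}\left(\frac{-4}n\right)e^{2\pi i(\frac{n^2}8\tau+\frac n2z)}$, where $\left(\frac{-4}n\right)$ is $1,-1,0$ for $n\equiv1\bmod4$, $n\equiv3\bmod4$, $n$ even. $A_1$ is the lattice $\mathbb Z$ with quadratic form $2x^2$. For a positive integer $t$, $k\in\mathbb Z$ and even $D$, $J_{k,A_1;t}(v_\eta^D)$ is the space of holomorphic $\varphi:\mathbb H\times\mathbb C\to\mathbb C$ with $\varphi(\frac{\alpha\tau+\beta}{\gamma\tau+\delta},\frac z{\gamma\tau+\delta})=v_\eta^D(A)(\gamma\tau+\delta)^ke^{2\pi i t\frac{\gamma z^2}{\gamma\tau+\delta}}\varphi(\tau,z)$ for $A\in\mathrm{SL}_2(\mathbb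 Z)$, $\varphi(\tau,z+x\tau+y)=e^{-2\pi it(x^2\tau+2xz)}\varphi(\tau,z)$ for $x,y\in\mathbb Z$, and a Fourier expansion $\varphi=\sum c(n,r)e^{2\pi i(n\tau+rz)}$ over rational $n\ge0$ with $n\equiv\frac D{24}\bmod\mathbb Z$ and $r\in\mathbb Z$ with $4nt-r^2\ge0$. It is a cusp form if $c(n,r)\neq0$ only for $4nt-r^2>0$. *)

theory Defs
  imports "HOL-Analysis.Analysis" "HOL-Number_Theory.Cong"
begin

definition upper_half_plane :: "complex set" where
  "upper_half_plane = {\<tau>. Im \<tau> > 0}"

definition SL2Z :: "(int^2^2) set" where
  "SL2Z = {A. det A = 1}"

definition moebius_denom :: "int^2^2 \<Rightarrow> complex \<Rightarrow> complex" where
  "moebius_denom A \<tau> = of_int (A $ 2 $ 1) * \<tau> + of_int (A $ 2 $ 2)"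

definition moebius_action :: "int^2^2 \<Rightarrow> complex \<Rightarrow> complex" where
  "moebius_action A \<tau> = (of_int (A $ 1 $ 1) * \<tau> + of_int (A $ 1 $ 2)) / moebius_denom A \<tau>"

definition dedekind_eta :: "complex \<Rightarrow> complex" where
  "dedekind_eta \<tau> =
     exp (2 * of_real pi * \<i> * \<tau> / 24) *
     (\<Prod>n. 1 - exp (2 * of_real pi * \<i> * of_nat (Suc n) * \<tau>))"

text \<open>
  The half-integral power is the principal branch \<^const>\<open>csqrt\<close>. A different choice of branch
  changes \<open>eta_multiplier A\<close> only by a sign, which is invisible in its even powers.
  The value is unique because the eta function has no zeros in the upper half-plane.
\<close>
definition eta_multiplier :: "int^2^2 \<Rightarrow> complex" where
  "eta_multiplier A =
     (THE v. \<forall>\<tau>\<in>upper_half_plane.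
        dedekind_eta (moebius_action A \<tau>) = v * csqrt (moebius_denom A \<tau>) * dedekind_eta \<tau>)"

text \<open>The Kronecker symbol of \<open>-4\<close> over \<open>n\<close>.\<close>
definition kronecker_m4 :: "int \<Rightarrow> int" where
  "kronecker_m4 n = (if [n = 1] (mod 4) then 1 else if [n = 3] (mod 4) then -1 else 0)"

definition jacobi_theta :: "complex \<Rightarrow> complex \<Rightarrow> complex" where
  "jacobi_theta \<tau> z =
     (\<Sum>\<^sub>\<infinity>n\<in>UNIV. of_int (kronecker_m4 n) *
        exp (2 * of_real pi * \<i> * (of_int n ^ 2 / 8 * \<tau> + of_int n / 2 * z)))"

text \<open>
  Holomorphy in two variables: at every point there is a total derivative that is
  complex linear. Functions on the upper half-plane times the complex plane are represented by
  total functions whose values at other points play no role.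
\<close>
definition holomorphic2_on :: "(complex \<Rightarrow> complex \<Rightarrow> complex) \<Rightarrow> (complex \<times> complex) set \<Rightarrow> bool" where
  "holomorphic2_on \<phi> S \<longleftrightarrow>
     (\<forall>p\<in>S. \<exists>u v. ((\<lambda>(\<tau>, z). \<phi> \<tau> z) has_derivative (\<lambda>(h, k). u * h + v * k)) (at p within S))"

definition jacobi_modular :: "int \<Rightarrow> nat \<Rightarrow> int \<Rightarrow> (complex \<Rightarrow> complex \<Rightarrow> complex) \<Rightarrow> bool" where
  "jacobi_modular k t D \<phi> \<longleftrightarrow>
     (\<forall>A\<in>SL2Z. \<forall>\<tau>\<in>upper_half_plane. \<forall>z.
        \<phi> (moebius_action A \<tau>) (z / moebius_denom A \<tau>) =
          eta_multiplier A powi D * moebius_denom A \<tau> powi k *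
          exp (2 * of_real pi * \<i> * of_nat t * (of_int (A $ 2 $ 1) * z ^ 2 / moebius_denom A \<tau>)) *
          \<phi> \<tau> z)"

definition jacobi_elliptic :: "nat \<Rightarrow> (complex \<Rightarrow> complex \<Rightarrow> complex) \<Rightarrow> bool" where
  "jacobi_elliptic t \<phi> \<longleftrightarrow>
     (\<forall>x y :: int. \<forall>\<tau>\<in>upper_half_plane. \<forall>z.
        \<phi> \<tau> (z + of_int x * \<tau> + of_int y) =
          exp (- 2 * of_real pi * \<i> * of_nat t * (of_int x ^ 2 * \<tau> + 2 * of_int x * z)) * \<phi> \<tau> z)"

definition jacobi_exponents :: "nat \<Rightarrow> int \<Rightarrow> (rat \<times> int) set" where
  "jacobi_exponents t D =
     {(n, r). n \<ge> 0 \<and> n - of_int D / 24 \<in> \<int> \<and> 4 * n * of_nat t - of_int r ^ 2 \<ge> 0}"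

definition jacobi_fourier_expansion ::
    "nat \<Rightarrow> int \<Rightarrow> (complex \<Rightarrow> complex \<Rightarrow> complex) \<Rightarrow> (rat \<Rightarrow> int \<Rightarrow> complex) \<Rightarrow> bool" where
  "jacobi_fourier_expansion t D \<phi> c \<longleftrightarrow>
     (\<forall>\<tau>\<in>upper_half_plane. \<forall>z.
        ((\<lambda>(n, r). c n r * exp (2 * of_real pi * \<i> * (of_rat n * \<tau> + of_int r * z)))
           has_sum \<phi> \<tau> z) (jacobi_exponents t D))"

text \<open>\<open>jacobi_forms k t D\<close> is $J_{k,A_1;t}(v_\eta^D)$, for $t > 0$ and even $D$.\<close>
definition jacobi_forms :: "int \<Rightarrow> nat \<Rightarrow> int \<Rightarrow> (complex \<Rightarrow> complex \<Rightarrow> complex) set" where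
  "jacobi_forms k t D =
     {\<phi>. holomorphic2_on \<phi> (upper_half_plane \<times> UNIV) \<and> jacobi_modular k t D \<phi> \<and>
         jacobi_elliptic t \<phi> \<and> (\<exists>c. jacobi_fourier_expansion t D \<phi> c)}"

definition jacobi_cusp_forms :: "int \<Rightarrow> nat \<Rightarrow> int \<Rightarrow> (complex \<Rightarrow> complex \<Rightarrow> complex) set" where
  "jacobi_cusp_forms k t D =
     {\<phi> \<in> jacobi_forms k t D. \<exists>c. jacobi_fourier_expansion t D \<phi> c \<and>
         (\<forall>(n, r)\<in>jacobi_exponents t D. c n r \<noteq> 0 \<longrightarrow> 4 * n * of_nat t - of_int r ^ 2 > 0)}"

definition theta_quark :: "nat \<Rightarrow> nat \<Rightarrow> complex \<Rightarrow> complex \<Rightarrow> complex" where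
  "theta_quark a b \<tau> z =
     jacobi_theta \<tau> (of_nat a * z) * jacobi_theta \<tau> (of_nat b * z) *
     jacobi_theta \<tau> (of_nat (a + b) * z) / dedekind_eta \<tau>"

end

theory Submission
  imports Defs "HOL-Complex_Analysis.Complex_Analysis" "HOL-Library.Periodic_Fun"
begin

text \<open>
  Write \<open>\<theta>\<close> for the Jacobi theta function, \<open>q = e1 \<tau>\<close> and \<open>e1 x = exp (2 \<pi> \<i> x)\<close>.

  The behaviour at the cusp comes from an explicit Fourier expansion, the Macdonald identity of type
  \<open>A\<^sub>2\<close> (\<open>theta_quark_has_sum\<close>):
  \<open>\<theta>(\<tau>,x) \<theta>(\<tau>,y) \<theta>(\<tau>,x+y) / \<eta>(\<tau>) = \<Sum> \<epsilon>(r+s) e1 ((r\<^sup>2 - r s + s\<^sup>2)/3 \<tau> + r x + s y)\<close>, the sum over all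
  integers \<open>r, s\<close>, where \<open>\<epsilon>(m)\<close> is \<open>0, -1, 1\<close> for \<open>m \<equiv> 0, 1, 2\<close> modulo 3.
  Indeed, if the product of the three theta series is summed over the odd integers \<open>(k, l, n)\<close>, the
  exponents of \<open>x\<close> and \<open>y\<close> are \<open>r = (k+n)/2\<close> and \<open>s = (l+n)/2\<close>, and
  \<open>(k\<^sup>2 + l\<^sup>2 + n\<^sup>2)/8 = (r\<^sup>2 - r s + s\<^sup>2)/3 + (2(r+s) - 3n)\<^sup>2/24\<close>. For fixed \<open>r, s\<close> the sum over \<open>n\<close> is
  therefore, up to sign, Euler's pentagonal series for \<open>\<eta>\<close>, or zero if \<open>3\<close> divides \<open>r+s\<close>
  (\<open>mod3_sign_has_sum\<close>). With \<open>x = a z\<close>, \<open>y = b z\<close> and \<open>t = a\<^sup>2 + a b + b\<^sup>2\<close>, the discriminant of the term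
  \<open>(r, s)\<close> is \<open>((a + 2b) r - (2a + b) s)\<^sup>2 / 3\<close>. It is never negative, and as
  \<open>(a + 2b) r - (2a + b) s \<equiv> (a - b)(r + s)\<close> modulo 3, it is positive if \<open>a\<close> and \<open>b\<close> are incongruent modulo 3.

  The Jacobi triple product (\<open>jacobi_triple_product\<close>) is the limit of a finite identity. It gives the
  pentagonal series, the simple zeros of \<open>\<theta>(\<tau>,\<cdot>)\<close> at the lattice points, and
  \<open>\<theta>'(\<tau>,0) = 2 \<pi> \<i> \<eta>(\<tau>)\<^sup>3\<close>.

  For the transformation law under a matrix \<open>A\<close> with lower row \<open>(c, d)\<close>, put \<open>j = c \<tau> + d\<close>. The entire
  function \<open>z \<mapsto> \<theta>(A \<tau>, z/j) e1 (- c z\<^sup>2/(2 j))\<close> has the quasi-periods of \<open>\<theta>(\<tau>,\<cdot>)\<close> and vanishes at the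
  lattice points, so by Liouville's theorem it is \<open>C(\<tau>) \<theta>(\<tau>,z)\<close>. Comparing the first and third
  Taylor coefficients at \<open>z = 0\<close> by means of the heat equation gives \<open>C' = c/(2 j) C\<close>, hence
  \<open>C\<^sup>2/j\<close> is constant. As \<open>\<eta>(A \<tau>)\<^sup>3 = C j \<eta>(\<tau>)\<^sup>3\<close>, the sixth power of \<open>\<eta>(A \<tau>) / (j\<^sup>1\<^sup>/\<^sup>2 \<eta>(\<tau>))\<close> is constant,
  and so is this quotient by continuity. Its value is the eta multiplier \<open>v\<close>, and
  \<open>C = v\<^sup>3 j\<^sup>1\<^sup>/\<^sup>2\<close>; the theta quark acquires the factor \<open>C\<^sup>3 / (v j\<^sup>1\<^sup>/\<^sup>2) = v\<^sup>8 j\<close>.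
\<close>

section \<open>Theta series and their derivatives\<close>

text \<open>Termwise total differentiation of a series of functions of two complex variables, under
  a uniform summable bound on the partial derivatives.\<close>
lemma has_derivative_series2:
  fixes f :: "nat \<Rightarrow> complex \<times> complex \<Rightarrow> complex"
  assumes "open S" "convex S" "p \<in> S"
    and der: "\<And>n x. x \<in> S \<Longrightarrow> (f n has_derivative (\<lambda>(h, k). u n x * h + v n x * k)) (at x)"
    and u: "\<And>n x. x \<in> S \<Longrightarrow> norm (u n x) \<le> M n"
    and v: "\<And>n x. x \<in> S \<Longrightarrow> norm (v n x) \<le> M n"
    and "summable M" and sf: "\<And>x. x \<in> S \<Longrightarrow> summable (\<lambda>n. f n x)"
  shows "((\<lambda>x. \<Sum>n. f n x) has_derivative (\<lambda>(h, k). (\<Sum>n. u n p) * h + (\<Sum>n. v n p) * k)) (at p)"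
proof -
  have su: "summable (\<lambda>n. u n x)" "summable (\<lambda>n. v n x)" if "x \<in> S" for x
    using u[OF that] v[OF that] \<open>summable M\<close> by (auto intro: summable_comparison_test)
  have ulu: "uniform_limit S (\<lambda>n x. \<Sum>i<n. u i x) (\<lambda>x. \<Sum>i. u i x) sequentially"
    using u \<open>summable M\<close> by (intro Weierstrass_m_test) auto
  have ulv: "uniform_limit S (\<lambda>n x. \<Sum>i<n. v i x) (\<lambda>x. \<Sum>i. v i x) sequentially"
    using v \<open>summable M\<close> by (intro Weierstrass_m_test) auto
  have "\<exists>g. \<forall>x\<in>S. (\<lambda>n. f n x) sums g x \<and>
      (g has_derivative (\<lambda>(h, k). (\<Sum>n. u n x) * h + (\<Sum>n. v n x) * k)) (at x within S)"
  proof (rule has_derivative_series[OF \<open>convex S\<close> _ _ \<open>p \<in> S\<close>])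
    show "(f n has_derivative (\<lambda>(h, k). u n x * h + v n x * k)) (at x within S)" if "x \<in> S" for n x
      using der[OF that] by (rule has_derivative_at_withinI)
    show "(\<lambda>n. f n p) sums (\<Sum>n. f n p)"
      using sf[OF \<open>p \<in> S\<close>] by (rule summable_sums)
    fix e :: real assume "e > 0"
    have "\<forall>\<^sub>F n in sequentially. \<forall>x\<in>S. dist (\<Sum>i<n. u i x) (\<Sum>i. u i x) < e / 2"
      using uniform_limitD[OF ulu, of "e / 2"] \<open>e > 0\<close> by simp
    moreover have "\<forall>\<^sub>F n in sequentially. \<forall>x\<in>S. dist (\<Sum>i<n. v i x) (\<Sum>i. v i x) < e / 2"
      using uniform_limitD[OF ulv, of "e / 2"] \<open>e > 0\<close> by simp
    ultimately show "\<forall>\<^sub>F n in sequentially. \<forall>x\<in>S. \<forall>h.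
        norm ((\<Sum>i<n. (\<lambda>(h, k). u i x * h + v i x * k) h) -
          (\<lambda>(h, k). (\<Sum>n. u n x) * h + (\<Sum>n. v n x) * k) h) \<le> e * norm h"
    proof eventually_elim
      case (elim n)
      show ?case
      proof (intro ballI allI)
        fix x and p :: "complex \<times> complex" assume x: "x \<in> S"
        obtain h k where p: "p = (h, k)" by (cases p)
        let ?a = "(\<Sum>i<n. u i x) - (\<Sum>i. u i x)" and ?b = "(\<Sum>i<n. v i x) - (\<Sum>i. v i x)"
        have "norm (?a * h + ?b * k) \<le> norm ?a * norm h + norm ?b * norm k"
          by (metis norm_mult norm_triangle_ineq)
        also have "\<dots> \<le> (e / 2) * norm p + (e / 2) * norm p"
          using elim x \<open>e > 0\<close> unfolding p
          by (intro add_mono mult_mono)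
             (auto simp: dist_norm norm_fst_le norm_snd_le less_imp_le
                norm_fst_le[of h k, simplified] norm_snd_le[of k h, simplified])
        finally have "norm (?a * h + ?b * k) \<le> e * norm p" by simp
        moreover have "(\<Sum>i<n. (\<lambda>(h, k). u i x * h + v i x * k) p) -
          (\<lambda>(h, k). (\<Sum>n. u n x) * h + (\<Sum>n. v n x) * k) p = ?a * h + ?b * k"
          by (simp add: p sum.distrib sum_distrib_left algebra_simps)
        ultimately show "norm ((\<Sum>i<n. (\<lambda>(h, k). u i x * h + v i x * k) p) -
          (\<lambda>(h, k). (\<Sum>n. u n x) * h + (\<Sum>n. v n x) * k) p) \<le> e * norm p" by simp
      qed
    qed
  qed
  then obtain g where g: "\<And>x. x \<in> S \<Longrightarrow> (\<lambda>n. f n x) sums g x"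
    "\<And>x. x \<in> S \<Longrightarrow> (g has_derivative (\<lambda>(h, k). (\<Sum>n. u n x) * h + (\<Sum>n. v n x) * k)) (at x within S)"
    by blast
  have "(g has_derivative (\<lambda>(h, k). (\<Sum>n. u n p) * h + (\<Sum>n. v n p) * k)) (at p)"
    using g(2)[OF \<open>p \<in> S\<close>] unfolding at_within_open[OF \<open>p \<in> S\<close> \<open>open S\<close>] .
  then show ?thesis
    by (rule has_derivative_transform_within_open[OF _ \<open>open S\<close> \<open>p \<in> S\<close>])
       (simp add: sums_unique[OF g(1)])
qed

text \<open>The \<open>n\<close>-th term of the \<open>k\<close>-th derivative in \<open>z\<close> of the theta series.\<close>
definition theta_term :: "nat \<Rightarrow> int \<Rightarrow> complex \<Rightarrow> complex \<Rightarrow> complex" where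
  "theta_term k n \<tau> z = of_int (kronecker_m4 n) * (of_real pi * \<i> * of_int n) ^ k *
     exp (of_real pi * \<i> * (of_int n ^ 2 / 4 * \<tau> + of_int n * z))"

text \<open>The \<open>k\<close>-th derivative of the theta function with respect to \<open>z\<close>.\<close>
definition theta_deriv :: "nat \<Rightarrow> complex \<Rightarrow> complex \<Rightarrow> complex" where
  "theta_deriv k \<tau> z = (\<Sum>\<^sub>\<infinity>n. theta_term k n \<tau> z)"

lemma jacobi_theta_eq: "jacobi_theta \<tau> z = theta_deriv 0 \<tau> z"
  unfolding jacobi_theta_def theta_deriv_def theta_term_def by (simp add: algebra_simps)

lemma power_le_fact_exp:
  fixes t :: real
  assumes "t \<ge> 0"
  shows "t ^ k \<le> fact k * exp t"
proof -
  have s: "summable (\<lambda>n. t ^ n /\<^sub>R fact n)" by (rule summable_exp_generic)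
  have "t ^ k /\<^sub>R fact k = (\<Sum>n\<in>{k}. t ^ n /\<^sub>R fact n)" by simp
  also have "\<dots> \<le> exp t"
    unfolding exp_def by (rule sum_le_suminf[OF s]) (use assms in auto)
  finally show ?thesis by (simp add: field_simps)
qed

lemma summable_exp_neg_abs_int: "(\<lambda>n::int. exp (- real_of_int \<bar>n\<bar>)) summable_on UNIV"
proof -
  have nat: "(\<lambda>n::nat. exp (- real n)) summable_on UNIV"
  proof (rule norm_summable_imp_summable_on)
    have "summable (\<lambda>n. exp (-1 :: real) ^ n)" by (intro summable_geometric) auto
    then show "summable (\<lambda>n::nat. norm (exp (- real n)))"
      by (simp add: exp_of_nat_mult[symmetric])
  qed
  have "(\<lambda>n::int. exp (- real_of_int \<bar>n\<bar>)) summable_on (int ` UNIV)"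
    using nat by (subst summable_on_reindex) (auto simp: o_def)
  moreover have "(\<lambda>n::int. exp (- real_of_int \<bar>n\<bar>)) summable_on ((\<lambda>n. - int n) ` UNIV)"
    using nat by (subst summable_on_reindex) (auto simp: o_def inj_on_def)
  ultimately have "(\<lambda>n::int. exp (- real_of_int \<bar>n\<bar>)) summable_on (int ` UNIV \<union> (\<lambda>n. - int n) ` UNIV)"
    by (rule summable_on_union)
  also have "int ` UNIV \<union> (\<lambda>n. - int n) ` UNIV = UNIV"
    by (auto simp: image_iff) (metis int_cases2)
  finally show ?thesis .
qed

lemma norm_kronecker_m4_le: "norm (of_int (kronecker_m4 n) :: complex) \<le> 1"
  by (simp add: kronecker_m4_def)

lemma gaussian_exponent_le:
  fixes \<alpha> \<beta> x :: real
  assumes "\<alpha> > 0"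
  shows "- \<alpha> * x ^ 2 + \<beta> * \<bar>x\<bar> \<le> (\<beta> + 1) ^ 2 / (4 * \<alpha>) - \<bar>x\<bar>"
proof -
  have "0 \<le> (2 * \<alpha> * \<bar>x\<bar> - (\<beta> + 1)) ^ 2" by simp
  then have "4 * \<alpha> * ((\<beta> + 1) * \<bar>x\<bar> - \<alpha> * \<bar>x\<bar> ^ 2) \<le> (\<beta> + 1) ^ 2"
    by (simp add: power2_eq_square algebra_simps)
  then have "(\<beta> + 1) * \<bar>x\<bar> - \<alpha> * \<bar>x\<bar> ^ 2 \<le> (\<beta> + 1) ^ 2 / (4 * \<alpha>)"
    using assms by (simp add: field_simps)
  then show ?thesis by (simp add: algebra_simps)
qed

text \<open>The quadratic exponent dominates the polynomial and the linear exponential factor, which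
  leaves a geometric series, uniformly for \<open>\<tau>\<close> bounded away from the real axis and \<open>z\<close> in a strip.\<close>
lemma theta_term_bound:
  assumes "\<delta> > 0"
  obtains K where "K \<ge> 0"
    "\<And>n \<tau> z. Im \<tau> \<ge> \<delta> \<Longrightarrow> \<bar>Im z\<bar> \<le> R \<Longrightarrow> norm (theta_term k n \<tau> z) \<le> K * exp (- real_of_int \<bar>n\<bar>)"
proof
  define \<alpha> where "\<alpha> = pi * \<delta> / 4"
  define \<beta> where "\<beta> = pi * R + pi"
  define K where "K = fact k * exp ((\<beta> + 1) ^ 2 / (4 * \<alpha>))"
  show "K \<ge> 0" by (simp add: K_def)
  fix n \<tau> z assume \<tau>: "Im \<tau> \<ge> \<delta>" and z: "\<bar>Im z\<bar> \<le> R"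
  have 1: "- (pi * (real_of_int n ^ 2 / 4 * Im \<tau> + real_of_int n * Im z)) \<le>
      - \<alpha> * real_of_int n ^ 2 + pi * R * \<bar>real_of_int n\<bar>"
  proof -
    have "real_of_int n ^ 2 / 4 * \<delta> \<le> real_of_int n ^ 2 / 4 * Im \<tau>"
      using \<tau> by (intro mult_left_mono) auto
    moreover have "- (real_of_int n * Im z) \<le> R * \<bar>real_of_int n\<bar>"
    proof -
      have "- (real_of_int n * Im z) \<le> \<bar>real_of_int n\<bar> * \<bar>Im z\<bar>" by (metis abs_ge_minus_self abs_mult)
      also have "\<dots> \<le> \<bar>real_of_int n\<bar> * R" using z by (intro mult_left_mono) auto
      finally show ?thesis by (simp add: mult.commute)
    qed
    ultimately have "- (real_of_int n ^ 2 / 4 * Im \<tau> + real_of_int n * Im z) \<le>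
       - (real_of_int n ^ 2 / 4 * \<delta>) + R * \<bar>real_of_int n\<bar>" by linarith
    then have "pi * - (real_of_int n ^ 2 / 4 * Im \<tau> + real_of_int n * Im z) \<le>
       pi * (- (real_of_int n ^ 2 / 4 * \<delta>) + R * \<bar>real_of_int n\<bar>)" by (intro mult_left_mono) auto
    then show ?thesis by (simp add: \<alpha>_def algebra_simps)
  qed
  have "norm (theta_term k n \<tau> z) \<le> (pi * \<bar>real_of_int n\<bar>) ^ k *
      exp (- (pi * (real_of_int n ^ 2 / 4 * Im \<tau> + real_of_int n * Im z)))"
    unfolding theta_term_def norm_mult norm_power norm_exp_eq_Re
    using norm_kronecker_m4_le[of n]
    by (auto simp: power2_eq_square algebra_simps intro!: mult_left_le_one_le mult_left_le)
  also have "\<dots> \<le> (fact k * exp (pi * \<bar>real_of_int n\<bar>)) *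
      exp (- \<alpha> * real_of_int n ^ 2 + pi * R * \<bar>real_of_int n\<bar>)"
    using 1 by (intro mult_mono power_le_fact_exp) auto
  also have "\<dots> = fact k * exp (- \<alpha> * real_of_int n ^ 2 + \<beta> * \<bar>real_of_int n\<bar>)"
    by (simp add: \<beta>_def algebra_simps flip: exp_add)
  also have "\<dots> \<le> fact k * exp ((\<beta> + 1) ^ 2 / (4 * \<alpha>) - \<bar>real_of_int n\<bar>)"
    using gaussian_exponent_le[of \<alpha> "real_of_int n" \<beta>] assms by (intro mult_left_mono) (auto simp: \<alpha>_def)
  also have "\<dots> = K * exp (- real_of_int \<bar>n\<bar>)"
    by (simp add: K_def exp_diff exp_minus field_simps)
  finally show "norm (theta_term k n \<tau> z) \<le> K * exp (- real_of_int \<bar>n\<bar>)" .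
qed

lemma theta_term_abs_summable:
  assumes "Im \<tau> > 0"
  shows "(\<lambda>n. norm (theta_term k n \<tau> z)) summable_on UNIV"
proof -
  obtain K where "\<And>n. norm (theta_term k n \<tau> z) \<le> K * exp (- real_of_int \<bar>n\<bar>)"
    using theta_term_bound[OF assms, of "\<bar>Im z\<bar>" k] by (metis order_refl)
  moreover have "(\<lambda>n. K * exp (- real_of_int \<bar>n\<bar>)) summable_on UNIV"
    by (rule summable_on_cmult_right[OF summable_exp_neg_abs_int])
  ultimately show ?thesis
    by (rule Infinite_Sum.abs_summable_on_comparison_test'[rotated])
qed

lemma theta_term_has_sum:
  assumes "Im \<tau> > 0"
  shows "((\<lambda>n. theta_term k n \<tau> z) has_sum theta_deriv k \<tau> z) UNIV"
  unfolding theta_deriv_def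
  by (rule has_sum_infsum, rule abs_summable_summable, rule theta_term_abs_summable, rule assms)

lemma has_sum_int_imp_sums:
  fixes f :: "int \<Rightarrow> complex"
  assumes "(f has_sum S) UNIV"
  shows "(\<lambda>n. f (int_decode n)) sums S"
  by (rule has_sum_imp_sums) (use assms in \<open>simp add: has_sum_reindex_bij_betw[OF bij_int_decode]\<close>)

lemma summable_int_decode:
  fixes f :: "int \<Rightarrow> real"
  assumes "f summable_on UNIV"
  shows "summable (\<lambda>n. f (int_decode n))"
proof -
  have "((\<lambda>n. f (int_decode n)) has_sum infsum f UNIV) UNIV"
    using has_sum_infsum[OF assms] by (simp add: has_sum_reindex_bij_betw[OF bij_int_decode])
  then show ?thesis using has_sum_imp_sums sums_summable by blast
qed

text \<open>One derivative in \<open>\<tau>\<close> is \<open>1 / (4 \<pi> \<i>)\<close> times two derivatives in \<open>z\<close>: this is the heat equation.\<close>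
lemma theta_term_has_derivative:
  "((\<lambda>(\<tau>, z). theta_term k n \<tau> z) has_derivative
     (\<lambda>(h, l). theta_term (k + 2) n \<tau> z / (4 * of_real pi * \<i>) * h + theta_term (k + 1) n \<tau> z * l)) (at (\<tau>, z))"
proof -
  define c where "c = of_real pi * \<i>"
  define a where "a = of_int (kronecker_m4 n) * (c * of_int n) ^ k"
  define e where "e = exp (c * (of_int n ^ 2 / 4 * \<tau> + of_int n * z))"
  have [simp]: "c \<noteq> 0" by (simp add: c_def)
  have "((\<lambda>p. c * (of_int n ^ 2 / 4 * fst p + of_int n * snd p)) has_derivative
      (\<lambda>p. c * (of_int n ^ 2 / 4 * fst p + of_int n * snd p))) (at (\<tau>, z))"
    by (auto intro!: derivative_eq_intros)
  moreover have "(exp has_derivative (\<lambda>h. e * h)) (at (c * (of_int n ^ 2 / 4 * fst (\<tau>, z) + of_int n * snd (\<tau>, z))))"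
    using DERIV_exp by (simp add: e_def has_field_derivative_def)
  ultimately have "((\<lambda>p. exp (c * (of_int n ^ 2 / 4 * fst p + of_int n * snd p))) has_derivative
      (\<lambda>p. e * (c * (of_int n ^ 2 / 4 * fst p + of_int n * snd p)))) (at (\<tau>, z))"
    by (rule has_derivative_compose)
  then have "((\<lambda>p. a * exp (c * (of_int n ^ 2 / 4 * fst p + of_int n * snd p))) has_derivative
      (\<lambda>p. a * (e * (c * (of_int n ^ 2 / 4 * fst p + of_int n * snd p))))) (at (\<tau>, z))"
    by (rule has_derivative_mult_right)
  moreover have "a * (e * (c * (of_int n ^ 2 / 4 * h + of_int n * l))) =
      theta_term (k + 2) n \<tau> z / (4 * of_real pi * \<i>) * h + theta_term (k + 1) n \<tau> z * l" for h l
    unfolding theta_term_def mult.assoc[of 4] c_def[symmetric] e_def[symmetric]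
    by (simp add: a_def field_simps power2_eq_square)
  ultimately have "((\<lambda>p. theta_term k n (fst p) (snd p)) has_derivative
     (\<lambda>p. theta_term (k + 2) n \<tau> z / (4 * of_real pi * \<i>) * fst p + theta_term (k + 1) n \<tau> z * snd p)) (at (\<tau>, z))"
    by (simp add: theta_term_def a_def c_def)
  then show ?thesis by (simp add: case_prod_unfold)
qed

lemma theta_deriv_has_derivative:
  assumes "Im \<tau> > 0"
  shows "((\<lambda>(\<tau>, z). theta_deriv k \<tau> z) has_derivative
     (\<lambda>(h, l). theta_deriv (k + 2) \<tau> z / (4 * of_real pi * \<i>) * h + theta_deriv (k + 1) \<tau> z * l)) (at (\<tau>, z))"
proof -
  define \<delta> where "\<delta> = Im \<tau> / 2"
  define R where "R = \<bar>Im z\<bar> + 1"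
  define S where "S = {\<tau>. Im \<tau> > \<delta>} \<times> ({z. Im z < R} \<inter> {z. Im z > - R})"
  have "\<delta> > 0" using assms by (simp add: \<delta>_def)
  obtain K1 where K1: "K1 \<ge> 0" "\<And>n \<tau> z. Im \<tau> \<ge> \<delta> \<Longrightarrow> \<bar>Im z\<bar> \<le> R \<Longrightarrow>
      norm (theta_term (k + 1) n \<tau> z) \<le> K1 * exp (- real_of_int \<bar>n\<bar>)"
    using theta_term_bound[OF \<open>\<delta> > 0\<close>] by metis
  obtain K2 where K2: "K2 \<ge> 0" "\<And>n \<tau> z. Im \<tau> \<ge> \<delta> \<Longrightarrow> \<bar>Im z\<bar> \<le> R \<Longrightarrow>
      norm (theta_term (k + 2) n \<tau> z) \<le> K2 * exp (- real_of_int \<bar>n\<bar>)"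
    using theta_term_bound[OF \<open>\<delta> > 0\<close>] by metis
  define M where "M n = (K1 + K2) * exp (- real_of_int \<bar>int_decode n\<bar>)" for n
  have M: "summable M"
    unfolding M_def by (intro summable_mult summable_int_decode summable_exp_neg_abs_int)
  have S: "Im (fst x) > \<delta>" "\<bar>Im (snd x)\<bar> \<le> R" "Im (fst x) > 0" if "x \<in> S" for x
    using that \<open>\<delta> > 0\<close> by (auto simp: S_def)
  have sums: "(\<lambda>n. theta_term k (int_decode n) \<tau> z) sums theta_deriv k \<tau> z" if "Im \<tau> > 0" for k \<tau> z
    using theta_term_has_sum[OF that] by (rule has_sum_int_imp_sums)
  let ?u = "\<lambda>n x. theta_term (k + 2) (int_decode n) (fst x) (snd x) / (4 * of_real pi * \<i>)"
  let ?v = "\<lambda>n x. theta_term (k + 1) (int_decode n) (fst x) (snd x)"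
  have p: "(\<tau>, z) \<in> S" using assms by (auto simp: S_def \<delta>_def R_def)
  have opS: "open S" unfolding S_def
    by (intro open_Times open_Int open_halfspace_Im_gt open_halfspace_Im_lt)
  have "((\<lambda>x. \<Sum>n. (\<lambda>(\<tau>, z). theta_term k (int_decode n) \<tau> z) x) has_derivative
      (\<lambda>(h, l). (\<Sum>n. ?u n (\<tau>, z)) * h + (\<Sum>n. ?v n (\<tau>, z)) * l)) (at (\<tau>, z))"
  proof (rule has_derivative_series2[where M = M, OF opS _ p])
    show "convex S" unfolding S_def
      by (intro convex_Times convex_Int convex_halfspace_Im_gt convex_halfspace_Im_lt)
    show "summable M" by (rule M)
    fix n x assume x: "x \<in> S"
    show "((\<lambda>(\<tau>, z). theta_term k (int_decode n) \<tau> z) has_derivative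
        (\<lambda>(h, l). ?u n x * h + ?v n x * l)) (at x)"
      using theta_term_has_derivative[of k "int_decode n" "fst x" "snd x"] by simp
    have n1: "norm (?v n x) \<le> K1 * exp (- real_of_int \<bar>int_decode n\<bar>)"
      using S[OF x] by (intro K1) auto
    also have "\<dots> \<le> M n" using K1 K2 by (simp add: M_def)
    finally show "norm (?v n x) \<le> M n" .
    have "norm (?u n x) = norm (theta_term (k + 2) (int_decode n) (fst x) (snd x)) / (4 * pi)"
      by (simp add: norm_mult norm_divide)
    also have "\<dots> \<le> norm (theta_term (k + 2) (int_decode n) (fst x) (snd x)) / 1"
      by (intro divide_left_mono) (use pi_gt3 in auto)
    also have "\<dots> \<le> K2 * exp (- real_of_int \<bar>int_decode n\<bar>)"
      using S[OF x] K2(2)[of "fst x" "snd x"] by simp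
    also have "\<dots> \<le> M n" using K1 K2 by (simp add: M_def)
    finally show "norm (?u n x) \<le> M n" .
  next
    show "summable (\<lambda>n. (\<lambda>(\<tau>, z). theta_term k (int_decode n) \<tau> z) x)" if "x \<in> S" for x
      using sums[OF S(3)[OF that], THEN sums_summable] by (simp add: case_prod_unfold)
  qed
  moreover have "(\<Sum>n. ?u n (\<tau>, z)) = theta_deriv (k + 2) \<tau> z / (4 * of_real pi * \<i>)"
    using sums_divide[OF sums[OF assms, of "k + 2"], THEN sums_unique] by simp
  moreover have "(\<Sum>n. ?v n (\<tau>, z)) = theta_deriv (k + 1) \<tau> z"
    using sums[OF assms, of "k + 1", THEN sums_unique] by simp
  ultimately have "((\<lambda>x. \<Sum>n. (\<lambda>(\<tau>, z). theta_term k (int_decode n) \<tau> z) x) has_derivative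
      (\<lambda>(h, l). theta_deriv (k + 2) \<tau> z / (4 * of_real pi * \<i>) * h + theta_deriv (k + 1) \<tau> z * l)) (at (\<tau>, z))"
    by simp
  then show ?thesis
    by (rule has_derivative_transform_within_open[OF _ opS p])
       (use S sums[THEN sums_unique] in \<open>simp add: case_prod_unfold\<close>)
qed

lemma theta_deriv_DERIV_z [derivative_intros]:
  assumes "(g has_field_derivative g') (at z within A)" "Im \<tau> > 0"
  shows "((\<lambda>z. theta_deriv k \<tau> (g z)) has_field_derivative theta_deriv (k + 1) \<tau> (g z) * g') (at z within A)"
proof -
  have "((\<lambda>z. (\<lambda>(\<tau>, z). theta_deriv k \<tau> z) (\<tau>, z)) has_derivative
      (\<lambda>l. (\<lambda>(h, l). theta_deriv (k + 2) \<tau> (g z) / (4 * of_real pi * \<i>) * h + theta_deriv (k + 1) \<tau> (g z) * l) (0, l)))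
      (at (g z))"
    by (rule has_derivative_compose[where f = "\<lambda>z. (\<tau>, z)", OF _ theta_deriv_has_derivative[OF assms(2)]])
       (auto intro!: derivative_eq_intros)
  then have "((\<lambda>z. theta_deriv k \<tau> z) has_field_derivative theta_deriv (k + 1) \<tau> (g z)) (at (g z))"
    unfolding has_field_derivative_def case_prod_conv
    by (rule has_derivative_eq_rhs) (auto simp: fun_eq_iff)
  from DERIV_chain2[OF this assms(1)] show ?thesis .
qed

lemma theta_deriv_DERIV_tau [derivative_intros]:
  assumes "(g has_field_derivative g') (at \<tau> within A)" "Im (g \<tau>) > 0"
  shows "((\<lambda>\<tau>. theta_deriv k (g \<tau>) z) has_field_derivative
     theta_deriv (k + 2) (g \<tau>) z / (4 * of_real pi * \<i>) * g') (at \<tau> within A)"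
proof -
  have "((\<lambda>\<tau>. (\<lambda>(\<tau>, z). theta_deriv k \<tau> z) (\<tau>, z)) has_derivative
      (\<lambda>l. (\<lambda>(h, l). theta_deriv (k + 2) (g \<tau>) z / (4 * of_real pi * \<i>) * h + theta_deriv (k + 1) (g \<tau>) z * l) (l, 0)))
      (at (g \<tau>))"
    by (rule has_derivative_compose[where f = "\<lambda>\<tau>. (\<tau>, z)", OF _ theta_deriv_has_derivative[OF assms(2)]])
       (auto intro!: derivative_eq_intros)
  then have "((\<lambda>\<tau>. theta_deriv k \<tau> z) has_field_derivative theta_deriv (k + 2) (g \<tau>) z / (4 * of_real pi * \<i>)) (at (g \<tau>))"
    unfolding has_field_derivative_def case_prod_conv
    by (rule has_derivative_eq_rhs) (auto simp: fun_eq_iff)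
  from DERIV_chain2[OF this assms(1)] show ?thesis .
qed

lemma kronecker_m4_odd: "kronecker_m4 (2 * m + 1) = (if even m then 1 else -1)"
  unfolding kronecker_m4_def cong_def by (auto; presburger)

lemma kronecker_m4_even: "even n \<Longrightarrow> kronecker_m4 n = 0"
  unfolding kronecker_m4_def cong_def by (auto; presburger)

lemma kronecker_m4_uminus: "kronecker_m4 (- n) = - kronecker_m4 n"
  unfolding kronecker_m4_def cong_def by (auto; presburger)

lemma kronecker_m4_shift: "kronecker_m4 (n + 2 * x) = (if even x then 1 else -1) * kronecker_m4 n"
  unfolding kronecker_m4_def cong_def by (auto; presburger)

text \<open>Translation by a lattice vector, with the sign written as an exponential.\<close>
lemma jacobi_theta_elliptic:
  assumes "Im \<tau> > 0"
  shows "jacobi_theta \<tau> (z + of_int x * \<tau> + of_int y) =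
    exp (- of_real pi * \<i> * (of_int x ^ 2 * \<tau> + 2 * of_int x * z + of_int x + of_int y)) * jacobi_theta \<tau> z"
proof -
  have expi: "exp (of_real pi * \<i> * of_int m) = (if even m then 1 else -1)" for m :: int
  proof (cases "even m")
    case True
    then obtain l where "m = 2 * l" by blast
    then have "exp (of_real pi * \<i> * of_int m) = exp (2 * of_int l * of_real pi * \<i>)" by (simp add: algebra_simps)
    then show ?thesis using True exp_integer_2pi[of "of_int l"] by simp
  next
    case False
    then obtain l where "m = 2 * l + 1" using oddE by blast
    then have "exp (of_real pi * \<i> * of_int m) = exp (2 * of_int l * of_real pi * \<i>) * exp (of_real pi * \<i>)"
      by (simp add: algebra_simps flip: exp_add)
    then show ?thesis using False exp_integer_2pi[of "of_int l"] by simp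
  qed
  have shift: "theta_term 0 n \<tau> (z + of_int x * \<tau> + of_int y) =
     exp (- of_real pi * \<i> * (of_int x ^ 2 * \<tau> + 2 * of_int x * z + of_int x + of_int y)) *
      theta_term 0 (n + 2 * x) \<tau> z" for n
  proof (cases "even n")
    case True
    then show ?thesis by (simp add: theta_term_def kronecker_m4_even)
  next
    case False
    define c :: complex where "c = of_real pi * \<i>"
    have "c * (of_int n ^ 2 / 4 * \<tau> + of_int n * (z + of_int x * \<tau> + of_int y)) =
       (- c * (of_int x ^ 2 * \<tau> + 2 * of_int x * z + of_int x + of_int y) +
       c * (of_int (n + 2 * x) ^ 2 / 4 * \<tau> + of_int (n + 2 * x) * z)) + c * of_int (x + (n + 1) * y)"
      by (simp add: power2_eq_square field_simps)
    then have "exp (c * (of_int n ^ 2 / 4 * \<tau> + of_int n * (z + of_int x * \<tau> + of_int y))) =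
       (exp (- c * (of_int x ^ 2 * \<tau> + 2 * of_int x * z + of_int x + of_int y)) *
       exp (c * (of_int (n + 2 * x) ^ 2 / 4 * \<tau> + of_int (n + 2 * x) * z))) * exp (c * of_int (x + (n + 1) * y))"
      by (simp only: exp_add)
    moreover have "exp (c * of_int (x + (n + 1) * y)) = (if even x then 1 else -1)"
      unfolding c_def expi using False by auto
    ultimately show ?thesis
      unfolding theta_term_def by (simp add: kronecker_m4_shift flip: c_def)
  qed
  have "((\<lambda>n. theta_term 0 (n + 2 * x) \<tau> z) has_sum theta_deriv 0 \<tau> z) UNIV"
    using theta_term_has_sum[OF assms, of 0 z]
    by (subst has_sum_reindex_bij_witness[of UNIV "\<lambda>n. n - 2 * x" "\<lambda>n. n + 2 * x" UNIV "\<lambda>n. theta_term 0 n \<tau> z"]) auto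
  then have "((\<lambda>n. theta_term 0 n \<tau> (z + of_int x * \<tau> + of_int y)) has_sum
     exp (- of_real pi * \<i> * (of_int x ^ 2 * \<tau> + 2 * of_int x * z + of_int x + of_int y)) * theta_deriv 0 \<tau> z) UNIV"
    unfolding shift by (rule has_sum_cmult_right)
  then show ?thesis
    using theta_term_has_sum[OF assms, of 0 "z + of_int x * \<tau> + of_int y"]
    unfolding jacobi_theta_eq by (rule has_sum_unique[THEN sym])
qed

lemma jacobi_theta_odd: "jacobi_theta \<tau> (- z) = - jacobi_theta \<tau> z"
proof -
  have "theta_deriv 0 \<tau> (- z) = (\<Sum>\<^sub>\<infinity>n. - theta_term 0 n \<tau> z)"
    unfolding theta_deriv_def
    by (rule infsum_reindex_bij_witness[of _ uminus uminus])
       (auto simp: theta_term_def kronecker_m4_uminus)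
  then show ?thesis by (simp add: jacobi_theta_eq theta_deriv_def infsum_uminus)
qed

section \<open>The Jacobi triple product\<close>

text \<open>The exponential function with period 1.\<close>
definition e1 :: "complex \<Rightarrow> complex" where
  "e1 x = exp (2 * of_real pi * \<i> * x)"

lemma e1_nonzero [simp]: "e1 x \<noteq> 0"
  by (simp add: e1_def)

lemma e1_0 [simp]: "e1 0 = 1"
  by (simp add: e1_def)

lemma e1_add: "e1 (x + y) = e1 x * e1 y"
  by (simp add: e1_def ring_distribs exp_add)

lemma e1_minus: "e1 (- x) = inverse (e1 x)"
  by (simp add: e1_def exp_minus)

lemma e1_diff: "e1 (x - y) = e1 x / e1 y"
  using e1_add[of x "- y"] by (simp add: e1_minus field_simps)

lemma e1_of_nat_mult: "e1 (of_nat n * x) = e1 x ^ n"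
  by (induction n) (simp_all add: e1_add ring_distribs)

lemma e1_eq_1_iff: "e1 x = 1 \<longleftrightarrow> x \<in> \<int>"
proof
  assume "e1 x = 1"
  then have "Re (2 * of_real pi * \<i> * x) = 0" "\<exists>n::int. Im (2 * of_real pi * \<i> * x) = of_int (2 * n) * pi"
    unfolding e1_def exp_eq_1 by auto
  then obtain n :: int where "Im x = 0" "Re x = of_int n" by auto
  then have "x = of_int n" by (simp add: complex_eq_iff)
  then show "x \<in> \<int>" by simp
next
  assume "x \<in> \<int>"
  then obtain n :: int where "x = of_int n" by (auto elim: Ints_cases)
  then show "e1 x = 1" unfolding e1_def exp_eq_1 by auto
qed

lemma norm_e1_less_1: "Im \<tau> > 0 \<Longrightarrow> norm (e1 \<tau>) < 1"
  by (simp add: e1_def)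

lemma theta_term_0_eq: "theta_term 0 n \<tau> z = of_int (kronecker_m4 n) * e1 (of_int n ^ 2 / 8 * \<tau> + of_int n / 2 * z)"
  by (simp add: theta_term_def e1_def algebra_simps)

text \<open>The product of the \<open>1 - u q\<^sup>n\<close> over \<open>n \<ge> 1\<close>.\<close>
definition euler_prod :: "complex \<Rightarrow> complex \<Rightarrow> complex" where
  "euler_prod q u = (\<Prod>n. 1 - u * q ^ Suc n)"

lemma convergent_euler_prod:
  fixes q u :: complex
  assumes "norm q < 1"
  shows "convergent_prod (\<lambda>n. 1 - u * q ^ Suc n)"
proof (rule abs_convergent_prod_imp_convergent_prod, rule summable_imp_abs_convergent_prod)
  have "summable (\<lambda>n. norm (u * q) * norm q ^ n)"
    using assms by (intro summable_mult summable_geometric) auto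
  then show "summable (\<lambda>n. norm (1 - u * q ^ Suc n - 1))"
    by (simp add: norm_mult norm_power mult.assoc)
qed

lemma LIMSEQ_euler_prod:
  assumes "norm q < 1"
  shows "(\<lambda>N. \<Prod>n<N. 1 - u * q ^ Suc n) \<longlonglongrightarrow> euler_prod q u"
  using convergent_prod_LIMSEQ[OF convergent_euler_prod[OF assms, of u]]
  unfolding euler_prod_def by (simp add: LIMSEQ_lessThan_iff_atMost)

lemma euler_prod_nonzero:
  assumes "norm q < 1" "\<And>n. u * q ^ Suc n \<noteq> 1"
  shows "euler_prod q u \<noteq> 0"
  unfolding euler_prod_def
  by (intro prodinf_nonzero convergent_euler_prod assms) (use assms(2) in \<open>metis eq_iff_diff_eq_0\<close>)

lemma euler_prod_1_nonzero:
  assumes "norm q < 1"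
  shows "euler_prod q 1 \<noteq> 0"
proof (rule euler_prod_nonzero[OF assms])
  fix n
  have "norm (q ^ Suc n) < 1" unfolding norm_power using assms by (intro power_less_one_iff[THEN iffD2]) auto
  then show "1 * q ^ Suc n \<noteq> 1" by auto
qed

lemma continuous_on_euler_prod_cball:
  assumes "norm q < 1"
  shows "continuous_on (cball 0 R) (euler_prod q)"
proof -
  have "uniformly_convergent_on (cball 0 R) (\<lambda>N u. \<Prod>n<N. 1 - u * q ^ Suc n)"
  proof (rule uniformly_convergent_on_prod')
    have "uniform_limit (cball 0 R) (\<lambda>N u. \<Sum>n<N. norm (1 - u * q ^ Suc n - 1))
        (\<lambda>u. \<Sum>n. norm (1 - u * q ^ Suc n - 1)) sequentially"
    proof (rule Weierstrass_m_test)
      show "summable (\<lambda>n. R * norm q * norm q ^ n)"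
        using assms by (intro summable_mult summable_geometric) auto
      fix n and u :: complex assume "u \<in> cball 0 R"
      then have "norm u * norm (q ^ Suc n) \<le> R * norm (q ^ Suc n)"
        by (intro mult_right_mono) auto
      then show "norm (norm (1 - u * q ^ Suc n - 1)) \<le> R * norm q * norm q ^ n"
        by (simp add: norm_mult norm_power mult.assoc)
    qed
    then show "uniformly_convergent_on (cball 0 R) (\<lambda>N u. \<Sum>n<N. norm (1 - u * q ^ Suc n - 1))"
      by (auto simp: uniformly_convergent_on_def)
  qed (auto intro!: continuous_intros)
  then obtain l where l: "uniform_limit (cball 0 R) (\<lambda>N u. \<Prod>n<N. 1 - u * q ^ Suc n) l sequentially"
    by (auto simp: uniformly_convergent_on_def)
  have eq: "l u = euler_prod q u" if "u \<in> cball 0 R" for u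
    using tendsto_uniform_limitI[OF l that] LIMSEQ_euler_prod[OF assms] by (rule LIMSEQ_unique)
  have "continuous_on (cball 0 R) l"
    by (rule uniform_limit_theorem[OF _ l]) (auto intro!: always_eventually continuous_intros)
  then show ?thesis
    using continuous_on_cong[of _ _ l "euler_prod q", OF refl eq] by blast
qed

lemma isCont_euler_prod:
  assumes "norm q < 1"
  shows "isCont (euler_prod q) u"
proof (rule continuous_on_interior)
  show "continuous_on (cball 0 (norm u + 1)) (euler_prod q)"
    by (rule continuous_on_euler_prod_cball[OF assms])
qed auto

text \<open>The finite product of the \<open>1 - q\<^sup>i\<close> over \<open>1 \<le> i \<le> n\<close>, where \<open>q = e1 \<tau>\<close>.\<close>
definition qfac :: "complex \<Rightarrow> nat \<Rightarrow> complex" where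
  "qfac \<tau> n = (\<Prod>i<n. 1 - e1 \<tau> ^ Suc i)"

text \<open>The reciprocal is extended by zero to negative integers, which makes its recursion
  hold at all integers.\<close>
definition inv_qfac :: "complex \<Rightarrow> int \<Rightarrow> complex" where
  "inv_qfac \<tau> m = (if m < 0 then 0 else 1 / qfac \<tau> (nat m))"

lemma qfac_nonzero:
  assumes "Im \<tau> > 0"
  shows "qfac \<tau> n \<noteq> 0"
proof -
  have "e1 \<tau> ^ Suc i \<noteq> 1" for i
  proof -
    have "norm (e1 \<tau> ^ Suc i) < 1"
      unfolding norm_power using norm_e1_less_1[OF assms] by (intro power_less_one_iff[THEN iffD2]) auto
    then show ?thesis by auto
  qed
  then show ?thesis by (auto simp: qfac_def)
qed

lemma inv_qfac_pred:
  assumes "Im \<tau> > 0"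
  shows "inv_qfac \<tau> (m - 1) = (1 - e1 (of_int m * \<tau>)) * inv_qfac \<tau> m"
proof (cases "m > 0")
  case True
  define k where "k = nat (m - 1)"
  have m: "m = int (Suc k)" using True by (simp add: k_def)
  have "qfac \<tau> (Suc k) = qfac \<tau> k * (1 - e1 (of_int m * \<tau>))"
    using e1_of_nat_mult[of "Suc k" \<tau>] by (simp add: qfac_def m del: power_Suc of_nat_Suc)
  moreover from this have "1 - e1 (of_int m * \<tau>) \<noteq> 0"
    using qfac_nonzero[OF assms, of "Suc k"] by auto
  ultimately show ?thesis
    using qfac_nonzero[OF assms, of k] unfolding inv_qfac_def
    by (simp add: m nat_add_distrib del: of_nat_Suc) (simp add: m)
qed (auto simp: inv_qfac_def)

text \<open>The finite form of the triple product, with a Gaussian binomial coefficient in each term.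
  The sum has finite support. Written as a sum over all integers it admits shifts of the index,
  and the induction step becomes a polynomial identity.\<close>
lemma finite_triple_product:
  assumes "Im \<tau> > 0"
  shows "((\<lambda>j. qfac \<tau> (2 * N) * inv_qfac \<tau> (int N + j) * inv_qfac \<tau> (int N - j) * theta_term 0 (2 * j - 1) \<tau> z)
     has_sum (- e1 (\<tau> / 8 - z / 2) * (\<Prod>k<N. (1 - e1 z * e1 \<tau> ^ k) * (1 - e1 (- z) * e1 \<tau> ^ Suc k)))) UNIV"
proof (induction N)
  case 0
  have "((\<lambda>j. qfac \<tau> 0 * inv_qfac \<tau> j * inv_qfac \<tau> (- j) * theta_term 0 (2 * j - 1) \<tau> z) has_sum
      (\<Sum>j\<in>{0}. qfac \<tau> 0 * inv_qfac \<tau> j * inv_qfac \<tau> (- j) * theta_term 0 (2 * j - 1) \<tau> z)) {0}"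
    by (rule has_sum_finite) simp
  moreover have "theta_term 0 (-1) \<tau> z = - e1 (\<tau> / 8 - z / 2)"
    using kronecker_m4_odd[of "-1"] by (simp add: theta_term_0_eq)
  ultimately have "((\<lambda>j. qfac \<tau> 0 * inv_qfac \<tau> j * inv_qfac \<tau> (- j) * theta_term 0 (2 * j - 1) \<tau> z) has_sum
      - e1 (\<tau> / 8 - z / 2)) {0}"
    by (simp add: qfac_def inv_qfac_def)
  then show ?case
    by (subst (asm) has_sum_cong_neutral[where T = UNIV]) (auto simp: inv_qfac_def)
next
  case (Suc N)
  define t where "t j = theta_term 0 (2 * j - 1) \<tau> z" for j
  define f where "f j = qfac \<tau> (2 * N) * inv_qfac \<tau> (int N + j) * inv_qfac \<tau> (int N - j) * t j" for j
  define P where "P = - e1 (\<tau> / 8 - z / 2) * (\<Prod>k<N. (1 - e1 z * e1 \<tau> ^ k) * (1 - e1 (- z) * e1 \<tau> ^ Suc k))"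
  define q where "q = e1 \<tau>"
  define w where "w = e1 z"
  have nz [simp]: "q \<noteq> 0" "w \<noteq> 0" by (simp_all add: q_def w_def)
  have f: "(f has_sum P) UNIV" using Suc unfolding f_def P_def t_def .
  have f1: "((\<lambda>j. f (j - 1)) has_sum P) UNIV"
    using f by (subst has_sum_reindex_bij_witness[of UNIV "\<lambda>n. n + 1" "\<lambda>n. n - 1" UNIV f]) auto
  have f2: "((\<lambda>j. f (j + 1)) has_sum P) UNIV"
    using f by (subst has_sum_reindex_bij_witness[of UNIV "\<lambda>n. n - 1" "\<lambda>n. n + 1" UNIV f]) auto
  have t1: "t (j - 1) * (w * q ^ N) = - (e1 (of_int (int N - j) * \<tau>) * q * t j)" for j
  proof -
    have "kronecker_m4 (2 * (j - 1) - 1) = - kronecker_m4 (2 * j - 1)"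
      using kronecker_m4_shift[of "2 * j - 1" "-1"] by (simp add: algebra_simps)
    moreover have "e1 (of_int (2 * (j - 1) - 1) ^ 2 / 8 * \<tau> + of_int (2 * (j - 1) - 1) / 2 * z) * (w * q ^ N) =
       e1 (of_int (int N - j) * \<tau>) * q * e1 (of_int (2 * j - 1) ^ 2 / 8 * \<tau> + of_int (2 * j - 1) / 2 * z)"
      unfolding q_def w_def e1_of_nat_mult[symmetric] e1_add[symmetric]
      by (rule arg_cong[where f = e1]) (simp add: field_simps power2_eq_square)
    ultimately show ?thesis unfolding t_def theta_term_0_eq by simp
  qed
  have t2: "t (j + 1) * (q ^ Suc N / w) = - (e1 (of_int (int N + j) * \<tau>) * q * t j)" for j
  proof -
    have "kronecker_m4 (2 * (j + 1) - 1) = - kronecker_m4 (2 * j - 1)"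
      using kronecker_m4_shift[of "2 * j - 1" "1"] by (simp add: algebra_simps)
    moreover have "e1 (of_int (2 * (j + 1) - 1) ^ 2 / 8 * \<tau> + of_int (2 * (j + 1) - 1) / 2 * z) * (q ^ Suc N / w) =
       e1 (of_int (int N + j) * \<tau>) * q * e1 (of_int (2 * j - 1) ^ 2 / 8 * \<tau> + of_int (2 * j - 1) / 2 * z)"
      unfolding q_def w_def e1_of_nat_mult[symmetric] e1_add[symmetric] e1_diff[symmetric]
      by (rule arg_cong[where f = e1]) (simp add: field_simps power2_eq_square)
    ultimately have "kronecker_m4 (2 * (j + 1) - 1) * (e1 (of_int (2 * (j + 1) - 1) ^ 2 / 8 * \<tau> + of_int (2 * (j + 1) - 1) / 2 * z) * (q ^ Suc N / w)) =
       - kronecker_m4 (2 * j - 1) * (e1 (of_int (int N + j) * \<tau>) * q * e1 (of_int (2 * j - 1) ^ 2 / 8 * \<tau> + of_int (2 * j - 1) / 2 * z))"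
      by (simp only:)
    then show ?thesis unfolding t_def theta_term_0_eq by (simp only: mult_ac of_int_minus mult_minus_left mult_minus_right)
  qed
  have "((\<lambda>j. (1 + q ^ (2 * N + 1)) * f j + - (w * q ^ N) * f (j - 1) + - (q ^ Suc N / w) * f (j + 1)) has_sum
      (1 + q ^ (2 * N + 1)) * P + - (w * q ^ N) * P + - (q ^ Suc N / w) * P) UNIV"
    by (intro has_sum_add has_sum_cmult_right f f1 f2)
  also have "(1 + q ^ (2 * N + 1)) * P + - (w * q ^ N) * P + - (q ^ Suc N / w) * P =
      - e1 (\<tau> / 8 - z / 2) * (\<Prod>k<Suc N. (1 - e1 z * e1 \<tau> ^ k) * (1 - e1 (- z) * e1 \<tau> ^ Suc k))"
    unfolding P_def by (simp add: e1_minus field_simps flip: q_def w_def mult_2 power_add)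
  also have "(\<lambda>j. (1 + q ^ (2 * N + 1)) * f j + - (w * q ^ N) * f (j - 1) + - (q ^ Suc N / w) * f (j + 1)) =
     (\<lambda>j. qfac \<tau> (2 * Suc N) * inv_qfac \<tau> (int (Suc N) + j) * inv_qfac \<tau> (int (Suc N) - j) * theta_term 0 (2 * j - 1) \<tau> z)"
  proof
    fix j
    define x where "x = e1 (of_int (int N + j) * \<tau>)"
    define y where "y = e1 (of_int (int N - j) * \<tau>)"
    define M where "M = inv_qfac \<tau> (int N + j + 1)"
    define L where "L = inv_qfac \<tau> (int N - j + 1)"
    define Q where "Q = qfac \<tau> (2 * N)"
    have M1: "inv_qfac \<tau> (int N + j) = (1 - x * q) * M"
    proof -
      have "e1 (of_int (int N + j + 1) * \<tau>) = x * q"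
        unfolding x_def q_def e1_add[symmetric] by (rule arg_cong[where f = e1]) (simp add: algebra_simps)
      then show ?thesis
        using inv_qfac_pred[OF assms, of "int N + j + 1"] by (simp add: M_def algebra_simps)
    qed
    have M2: "inv_qfac \<tau> (int N + (j - 1)) = (1 - x) * ((1 - x * q) * M)"
      using inv_qfac_pred[OF assms, of "int N + j"] unfolding M1 x_def[symmetric] by (simp add: algebra_simps)
    have L1: "inv_qfac \<tau> (int N - j) = (1 - y * q) * L"
    proof -
      have "e1 (of_int (int N - j + 1) * \<tau>) = y * q"
        unfolding y_def q_def e1_add[symmetric] by (rule arg_cong[where f = e1]) (simp add: algebra_simps)
      then show ?thesis
        using inv_qfac_pred[OF assms, of "int N - j + 1"] by (simp add: L_def algebra_simps)
    qed
    have L2: "inv_qfac \<tau> (int N - (j + 1)) = (1 - y) * ((1 - y * q) * L)"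
      using inv_qfac_pred[OF assms, of "int N - j"] unfolding L1 y_def[symmetric] by (simp add: algebra_simps)
    have xy: "q ^ (2 * N) = x * y"
      unfolding x_def y_def q_def e1_of_nat_mult[symmetric] e1_add[symmetric]
      by (rule arg_cong[where f = e1]) (simp add: algebra_simps)
    have Q: "qfac \<tau> (2 * Suc N) = Q * (1 - x * y * q) * (1 - x * y * q * q)"
      unfolding Q_def qfac_def q_def[symmetric] by (simp add: xy[unfolded mult.commute[of 2 N]] mult_ac)
    have "(w * q ^ N) * f (j - 1) = Q * inv_qfac \<tau> (int N + (j - 1)) * inv_qfac \<tau> (int N - (j - 1)) * (t (j - 1) * (w * q ^ N))"
      by (simp add: f_def Q_def)
    then have A: "(w * q ^ N) * f (j - 1) = - (Q * ((1 - x) * ((1 - x * q) * M)) * L * (y * q * t j))"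
      unfolding M2 t1 y_def[symmetric] by (simp add: L_def algebra_simps)
    have "(q ^ Suc N / w) * f (j + 1) = Q * inv_qfac \<tau> (int N + (j + 1)) * inv_qfac \<tau> (int N - (j + 1)) * (t (j + 1) * (q ^ Suc N / w))"
      by (simp add: f_def Q_def)
    then have B: "(q ^ Suc N / w) * f (j + 1) = - (Q * M * ((1 - y) * ((1 - y * q) * L)) * (x * q * t j))"
      unfolding L2 t2 x_def[symmetric] by (simp add: M_def algebra_simps)
    have C: "(1 + q ^ (2 * N + 1)) * f j = (1 + x * y * q) * (Q * ((1 - x * q) * M) * ((1 - y * q) * L) * t j)"
      unfolding f_def M1 L1 Q_def[symmetric] power_add xy by (simp add: mult_ac)
    have D: "qfac \<tau> (2 * Suc N) * inv_qfac \<tau> (int (Suc N) + j) * inv_qfac \<tau> (int (Suc N) - j) * theta_term 0 (2 * j - 1) \<tau> z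
       = Q * (1 - x * y * q) * (1 - x * y * q * q) * M * L * t j"
      unfolding Q by (simp add: M_def L_def t_def algebra_simps)
    show "(1 + q ^ (2 * N + 1)) * f j + - (w * q ^ N) * f (j - 1) + - (q ^ Suc N / w) * f (j + 1) =
       qfac \<tau> (2 * Suc N) * inv_qfac \<tau> (int (Suc N) + j) * inv_qfac \<tau> (int (Suc N) - j) * theta_term 0 (2 * j - 1) \<tau> z"
      unfolding mult_minus_left A B C D by (simp add: algebra_simps)
  qed
  finally show ?case .
qed

theorem jacobi_triple_product:
  assumes "Im \<tau> > 0"
  shows "jacobi_theta \<tau> z = - e1 (\<tau> / 8 - z / 2) * (1 - e1 z) *
     euler_prod (e1 \<tau>) 1 * euler_prod (e1 \<tau>) (e1 z) * euler_prod (e1 \<tau>) (e1 (- z))"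
proof -
  note q = norm_e1_less_1[OF assms]
  define E where "E = euler_prod (e1 \<tau>) 1"
  have E: "E \<noteq> 0" using euler_prod_1_nonzero[OF q] by (simp add: E_def)
  have qfac_lim: "qfac \<tau> \<longlonglongrightarrow> E"
    using LIMSEQ_euler_prod[OF q, of 1] unfolding E_def qfac_def by simp
  have inv_lim: "(\<lambda>n. 1 / qfac \<tau> n) \<longlonglongrightarrow> 1 / E"
    by (intro tendsto_intros qfac_lim E)
  \<comment> \<open>Convergent sequences are bounded, which gives the dominating series for the passage to the limit.\<close>
  obtain U where U: "U > 0" "\<And>n. norm (qfac \<tau> n) \<le> U"
    using convergent_imp_Bseq[OF convergentI[OF qfac_lim]] by (auto simp: Bseq_def)
  obtain B where B: "B > 0" "\<And>n. norm (1 / qfac \<tau> n) \<le> B"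
    using convergent_imp_Bseq[OF convergentI[OF inv_lim]] unfolding Bseq_def by metis
  have B': "norm (inv_qfac \<tau> m) \<le> B" for m
    using B unfolding inv_qfac_def by (auto simp: less_imp_le)
  define t where "t j = theta_term 0 (2 * j - 1) \<tau> z" for j
  define f where "f N j = qfac \<tau> (2 * N) * inv_qfac \<tau> (int N + j) * inv_qfac \<tau> (int N - j) * t j" for N j
  define P where "P N = - e1 (\<tau> / 8 - z / 2) * (\<Prod>k<N. (1 - e1 z * e1 \<tau> ^ k) * (1 - e1 (- z) * e1 \<tau> ^ Suc k))" for N
  \<comment> \<open>Only odd indices contribute to the theta series.\<close>
  have tsum: "(t has_sum jacobi_theta \<tau> z) UNIV"
  proof -
    have "(t has_sum jacobi_theta \<tau> z) UNIV \<longleftrightarrow>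
        ((\<lambda>n. theta_term 0 n \<tau> z) has_sum jacobi_theta \<tau> z) (range (\<lambda>j. 2 * j - 1))"
      unfolding t_def by (subst has_sum_reindex) (auto simp: inj_on_def o_def)
    also have "\<dots> \<longleftrightarrow> ((\<lambda>n. theta_term 0 n \<tau> z) has_sum jacobi_theta \<tau> z) UNIV"
    proof (rule has_sum_cong_neutral)
      fix n :: int assume n: "n \<in> UNIV - range (\<lambda>j. 2 * j - 1)"
      have "even n"
      proof (rule ccontr)
        assume "odd n"
        then have "n = 2 * ((n + 1) div 2) - 1" by presburger
        then show False using n by blast
      qed
      then show "theta_term 0 n \<tau> z = 0" by (simp add: theta_term_def kronecker_m4_even)
    qed auto
    finally show ?thesis
      using theta_term_has_sum[OF assms, of 0 z] by (simp add: jacobi_theta_eq)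
  qed
  have tabs: "summable (\<lambda>k. norm (t (int_decode k)))"
  proof (rule summable_int_decode)
    show "(\<lambda>j. norm (t j)) summable_on UNIV"
      using tsum summable_on_iff_abs_summable_on_complex has_sum_imp_summable by blast
  qed
  have lim_inv: "(\<lambda>N. inv_qfac \<tau> (int N + j)) \<longlonglongrightarrow> 1 / E" for j
  proof -
    have "filterlim (\<lambda>N. nat (int N + j)) at_top sequentially"
      by (rule filterlim_at_top_mono[OF filterlim_minus_const_nat_at_top[of "nat \<bar>j\<bar>"]])
         (auto intro!: always_eventually)
    then have "(\<lambda>N. 1 / qfac \<tau> (nat (int N + j))) \<longlonglongrightarrow> 1 / E"
      by (rule filterlim_compose[OF inv_lim])
    moreover have "\<forall>\<^sub>F N in sequentially. 1 / qfac \<tau> (nat (int N + j)) = inv_qfac \<tau> (int N + j)"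
      using eventually_ge_at_top[of "nat \<bar>j\<bar>"] by eventually_elim (auto simp: inv_qfac_def)
    ultimately show ?thesis by (rule Lim_transform_eventually)
  qed
  have lim2: "(\<lambda>N. qfac \<tau> (2 * N)) \<longlonglongrightarrow> E"
    by (rule filterlim_compose[OF qfac_lim]) (rule mult_nat_left_at_top, simp)
  have "(\<lambda>N. \<Sum>k. f N (int_decode k)) \<longlonglongrightarrow> (\<Sum>k. E * (1 / E) * (1 / E) * t (int_decode k))"
  proof (rule tannerys_theorem[THEN conjunct2, THEN conjunct2])
    show "(\<lambda>N. f N (int_decode k)) \<longlonglongrightarrow> E * (1 / E) * (1 / E) * t (int_decode k)" for k
      unfolding f_def using lim_inv[of "int_decode k"] lim_inv[of "- int_decode k"] lim2
      by (intro tendsto_mult tendsto_const) simp_all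
    show "summable (\<lambda>k. U * B * B * norm (t (int_decode k)))"
      by (intro summable_mult tabs)
    have "norm (f N j) \<le> U * B * B * norm (t j)" for N j
      unfolding f_def norm_mult using U B B' by (intro mult_right_mono mult_mono) (auto simp: less_imp_le)
    then show "\<forall>\<^sub>F (k, N) in at_top \<times>\<^sub>F sequentially. norm (f N (int_decode k)) \<le> U * B * B * norm (t (int_decode k))"
      by (auto intro!: always_eventually)
  qed simp
  also have "(\<lambda>N. \<Sum>k. f N (int_decode k)) = P"
  proof
    fix N
    have "(f N has_sum P N) UNIV"
      using finite_triple_product[OF assms, of N z] unfolding f_def P_def t_def .
    then show "(\<Sum>k. f N (int_decode k)) = P N"
      using has_sum_int_imp_sums sums_unique by metis
  qed
  also have "(\<Sum>k. E * (1 / E) * (1 / E) * t (int_decode k)) = jacobi_theta \<tau> z / E"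
    using sums_mult[OF has_sum_int_imp_sums[OF tsum], of "E * (1 / E) * (1 / E)", THEN sums_unique] E by simp
  finally have "(\<lambda>N. P (Suc N)) \<longlonglongrightarrow> jacobi_theta \<tau> z / E"
    by (rule LIMSEQ_Suc)
  moreover have "(\<lambda>N. P (Suc N)) \<longlonglongrightarrow> - e1 (\<tau> / 8 - z / 2) * ((1 - e1 z) *
      euler_prod (e1 \<tau>) (e1 z) * euler_prod (e1 \<tau>) (e1 (- z)))"
  proof -
    have "P (Suc N) = - e1 (\<tau> / 8 - z / 2) * ((1 - e1 z) * (\<Prod>k<N. 1 - e1 z * e1 \<tau> ^ Suc k) *
        (\<Prod>k<Suc N. 1 - e1 (- z) * e1 \<tau> ^ Suc k))" for N
      unfolding P_def prod.distrib by (subst prod.lessThan_Suc_shift) simp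
    then show ?thesis
      by (auto simp only: intro!: tendsto_intros LIMSEQ_euler_prod[OF q] LIMSEQ_Suc[OF LIMSEQ_euler_prod[OF q]])
  qed
  ultimately have "jacobi_theta \<tau> z / E = - e1 (\<tau> / 8 - z / 2) * ((1 - e1 z) *
      euler_prod (e1 \<tau>) (e1 z) * euler_prod (e1 \<tau>) (e1 (- z)))"
    by (rule LIMSEQ_unique)
  then show ?thesis using E by (simp add: field_simps E_def)
qed

lemma dedekind_eta_eq: "dedekind_eta \<tau> = e1 (\<tau> / 24) * euler_prod (e1 \<tau>) 1"
proof -
  have "exp (2 * of_real pi * \<i> * of_nat (Suc n) * \<tau>) = e1 \<tau> ^ Suc n" for n
    using e1_of_nat_mult[of "Suc n" \<tau>] by (simp only: e1_def mult.assoc)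
  then show ?thesis
    unfolding dedekind_eta_def euler_prod_def e1_def by simp
qed

lemma dedekind_eta_nonzero:
  assumes "Im \<tau> > 0"
  shows "dedekind_eta \<tau> \<noteq> 0"
  using euler_prod_1_nonzero[OF norm_e1_less_1[OF assms]] by (simp add: dedekind_eta_eq)

lemma jacobi_theta_zero_iff:
  assumes "Im \<tau> > 0"
  shows "jacobi_theta \<tau> z = 0 \<longleftrightarrow> (\<exists>m n :: int. z = of_int m * \<tau> + of_int n)"
proof
  note q = norm_e1_less_1[OF assms]
  assume "jacobi_theta \<tau> z = 0"
  then have "e1 z = 1 \<or> (\<exists>k. e1 z * e1 \<tau> ^ Suc k = 1) \<or> (\<exists>k. e1 (- z) * e1 \<tau> ^ Suc k = 1)"
    using jacobi_triple_product[OF assms, of z] euler_prod_1_nonzero[OF q]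
      euler_prod_nonzero[OF q, of "e1 z"] euler_prod_nonzero[OF q, of "e1 (- z)"]
    by auto
  then have "z \<in> \<int> \<or> (\<exists>k. z + of_nat (Suc k) * \<tau> \<in> \<int>) \<or> (\<exists>k. - z + of_nat (Suc k) * \<tau> \<in> \<int>)"
    unfolding e1_of_nat_mult[symmetric] e1_add[symmetric] e1_eq_1_iff .
  then show "\<exists>m n :: int. z = of_int m * \<tau> + of_int n"
  proof (elim disjE exE)
    assume "z \<in> \<int>"
    then obtain n where "z = of_int n" by (auto elim: Ints_cases)
    then show ?thesis by (intro exI[of _ 0] exI[of _ n]) simp
  next
    fix k assume "z + of_nat (Suc k) * \<tau> \<in> \<int>"
    then obtain n where "z + of_nat (Suc k) * \<tau> = of_int n" by (auto elim: Ints_cases)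
    then show ?thesis
      by (intro exI[of _ "- int (Suc k)"] exI[of _ n]) (simp add: algebra_simps)
  next
    fix k assume "- z + of_nat (Suc k) * \<tau> \<in> \<int>"
    then obtain n where "- z + of_nat (Suc k) * \<tau> = of_int n" by (auto elim: Ints_cases)
    then show ?thesis
      by (intro exI[of _ "int (Suc k)"] exI[of _ "- n"]) (simp add: algebra_simps)
  qed
next
  assume "\<exists>m n :: int. z = of_int m * \<tau> + of_int n"
  then obtain m n :: int where "z = 0 + of_int m * \<tau> + of_int n" by auto
  moreover have "jacobi_theta \<tau> 0 = 0" using jacobi_theta_odd[of \<tau> 0] by simp
  ultimately show "jacobi_theta \<tau> z = 0" by (simp only: jacobi_theta_elliptic[OF assms] mult_zero_right)
qed

lemma theta_deriv_1_0:
  assumes "Im \<tau> > 0"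
  shows "theta_deriv 1 \<tau> 0 = 2 * of_real pi * \<i> * dedekind_eta \<tau> ^ 3"
proof -
  note q = norm_e1_less_1[OF assms]
  \<comment> \<open>The triple product without its factor \<open>1 - e1 z\<close>, the only one that vanishes at 0.\<close>
  define K where "K z = - e1 (\<tau> / 8 - z / 2) *
     euler_prod (e1 \<tau>) 1 * euler_prod (e1 \<tau>) (e1 z) * euler_prod (e1 \<tau>) (e1 (- z))" for z
  have cont: "isCont K 0"
  proof -
    have "isCont (\<lambda>z. euler_prod (e1 \<tau>) (e1 (c * z))) 0" for c
      by (rule isCont_o2[OF _ isCont_euler_prod[OF q]]) (simp add: e1_def)
    from this[of 1] this[of "-1"] show ?thesis
      unfolding K_def by (intro continuous_intros) (simp_all add: e1_def)
  qed
  have "((\<lambda>z. 1 - e1 z) has_field_derivative - (2 * of_real pi * \<i>)) (at 0)"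
    unfolding e1_def by (auto intro!: derivative_eq_intros)
  then have "((\<lambda>z. (1 - e1 z) / z) \<longlongrightarrow> - (2 * of_real pi * \<i>)) (at 0)"
    by (simp add: has_field_derivative_iff)
  then have l1: "((\<lambda>z. (1 - e1 z) / z * K z) \<longlongrightarrow> - (2 * of_real pi * \<i>) * K 0) (at 0)"
    using cont by (intro tendsto_mult) (simp_all add: isCont_def)
  have "((\<lambda>z. theta_deriv 0 \<tau> z) has_field_derivative theta_deriv (0 + 1) \<tau> 0 * 1) (at 0)"
    by (rule theta_deriv_DERIV_z[OF DERIV_ident assms])
  then have l2: "((\<lambda>z. (theta_deriv 0 \<tau> z - theta_deriv 0 \<tau> 0) / z) \<longlongrightarrow> theta_deriv 1 \<tau> 0) (at 0)"
    by (simp add: has_field_derivative_iff)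
  have "(\<lambda>z. (theta_deriv 0 \<tau> z - theta_deriv 0 \<tau> 0) / z) = (\<lambda>z. (1 - e1 z) / z * K z)"
    unfolding jacobi_theta_eq[symmetric] jacobi_triple_product[OF assms] by (simp add: K_def fun_eq_iff)
  with l1 have "((\<lambda>z. (theta_deriv 0 \<tau> z - theta_deriv 0 \<tau> 0) / z) \<longlongrightarrow> - (2 * of_real pi * \<i>) * K 0) (at 0)"
    by simp
  with l2 have "theta_deriv 1 \<tau> 0 = - (2 * of_real pi * \<i>) * K 0"
    by (rule LIM_unique)
  moreover have "e1 (\<tau> / 8) = e1 (\<tau> / 24) ^ 3"
    by (simp flip: e1_of_nat_mult)
  ultimately show ?thesis
    by (simp add: K_def dedekind_eta_eq power3_eq_cube mult_ac)
qed

text \<open>Euler's pentagonal number theorem, read as a special value of the theta function.\<close>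
lemma dedekind_eta_pentagonal:
  assumes "Im \<tau> > 0"
  shows "dedekind_eta \<tau> = - e1 (\<tau> / 6) * jacobi_theta (3 * \<tau>) \<tau>"
proof -
  have 3: "Im (3 * \<tau>) > 0" using assms by simp
  define q where "q = e1 \<tau>"
  have q: "norm q < 1" "q \<noteq> 0" using norm_e1_less_1[OF assms] by (simp_all add: q_def)
  have q3: "norm (q ^ 3) < 1" "e1 (3 * \<tau>) = q ^ 3"
    using norm_e1_less_1[OF 3] e1_of_nat_mult[of 3 \<tau>] by (simp_all add: q_def)
  define A where "A u N = (\<Prod>k<N. 1 - u * (q ^ 3) ^ Suc k)" for u N
  have lim: "A u \<longlonglongrightarrow> euler_prod (q ^ 3) u" for u
    unfolding A_def by (rule LIMSEQ_euler_prod[OF q3(1)])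
  have part: "(1 - q) * A 1 N * A q N * A (inverse q) N = (\<Prod>k<3 * N + 1. 1 - 1 * q ^ Suc k)" for N
  proof (induction N)
    case (Suc N)
    have *: "inverse q * (q ^ 3) ^ Suc N = q ^ (3 * N + 2)" "q * (q ^ 3) ^ Suc N = q ^ (3 * N + 4)"
      "(q ^ 3) ^ Suc N = q ^ (3 * N + 3)"
      using q(2) by (simp_all add: field_simps power_mult_distrib power_mult[of q 3 N] power_add eval_nat_numeral)
    have S1: "A 1 (Suc N) = A 1 N * (1 - q ^ (3 * N + 3))"
      unfolding A_def prod.lessThan_Suc mult_1_left *(3) ..
    have S2: "A q (Suc N) = A q N * (1 - q ^ (3 * N + 4))"
      unfolding A_def prod.lessThan_Suc *(2) ..
    have S3: "A (inverse q) (Suc N) = A (inverse q) N * (1 - q ^ (3 * N + 2))"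
      unfolding A_def prod.lessThan_Suc *(1) ..
    have "(1 - q) * A 1 (Suc N) * A q (Suc N) * A (inverse q) (Suc N) =
       ((1 - q) * A 1 N * A q N * A (inverse q) N) *
       ((1 - q ^ (3 * N + 2)) * (1 - q ^ (3 * N + 3)) * (1 - q ^ (3 * N + 4)))"
      unfolding S1 S2 S3 by (simp only: mult_ac)
    also have "\<dots> = (\<Prod>k<Suc (Suc (Suc (3 * N + 1))). 1 - 1 * q ^ Suc k)"
      unfolding Suc.IH prod.lessThan_Suc mult_1_left by (simp add: eval_nat_numeral mult.assoc del: power_Suc)
    also have "Suc (Suc (Suc (3 * N + 1))) = 3 * Suc N + 1" by simp
    finally show ?case .
  qed (simp add: A_def)
  have "(\<lambda>N. (1 - q) * A 1 N * A q N * A (inverse q) N) \<longlonglongrightarrow>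
      (1 - q) * euler_prod (q ^ 3) 1 * euler_prod (q ^ 3) q * euler_prod (q ^ 3) (inverse q)"
    by (intro tendsto_intros lim)
  moreover have "(\<lambda>N. (1 - q) * A 1 N * A q N * A (inverse q) N) \<longlonglongrightarrow> euler_prod q 1"
    unfolding part
    by (rule filterlim_compose[OF LIMSEQ_euler_prod[OF q(1), of 1]])
       (auto intro!: filterlim_at_top_mono[OF filterlim_ident] always_eventually)
  ultimately have "(1 - q) * euler_prod (q ^ 3) 1 * euler_prod (q ^ 3) q * euler_prod (q ^ 3) (inverse q) =
      euler_prod q 1"
    by (rule LIMSEQ_unique)
  moreover have "e1 (\<tau> / 24) = e1 (\<tau> / 6) * e1 (3 * \<tau> / 8 - \<tau> / 2)"
    unfolding e1_add[symmetric] by (rule arg_cong[where f = e1]) simp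
  ultimately show ?thesis
    unfolding jacobi_triple_product[OF 3] dedekind_eta_eq q3 e1_minus q_def[symmetric] by (simp add: mult_ac)
qed

section \<open>Entire functions with the same quasi-periods\<close>

text \<open>A quotient of entire functions whose denominator has only simple zeros, all of them zeros
  of the numerator. At these zeros the removable singularity is filled by the quotient of the
  derivatives.\<close>
definition entire_quot :: "(complex \<Rightarrow> complex) \<Rightarrow> (complex \<Rightarrow> complex) \<Rightarrow> complex \<Rightarrow> complex" where
  "entire_quot f g z = (if g z = 0 then deriv f z / deriv g z else f z / g z)"

lemma entire_quot_holomorphic:
  assumes f: "f holomorphic_on UNIV" and g: "g holomorphic_on UNIV"
    and zero: "\<And>z. g z = 0 \<Longrightarrow> f z = 0 \<and> deriv g z \<noteq> 0"
  shows "entire_quot f g holomorphic_on UNIV"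
proof -
  have cont: "isCont h z" if "h holomorphic_on UNIV" for h and z :: complex
    using holomorphic_on_imp_continuous_on[OF that] by (simp add: continuous_on_eq_continuous_at)
  have "entire_quot f g field_differentiable (at z)" for z
  proof (cases "g z = 0")
    case False
    obtain d where d: "d > 0" "\<And>w. dist w z < d \<Longrightarrow> g w \<noteq> 0"
      using continuous_at_avoid[OF cont[OF g] False] by (metis dist_commute)
    have "(\<lambda>w. f w / g w) holomorphic_on ball z d"
      using d by (intro holomorphic_on_divide holomorphic_on_subset[OF f] holomorphic_on_subset[OF g])
        (auto simp: dist_commute)
    then have "entire_quot f g holomorphic_on ball z d"
      by (rule holomorphic_transform) (use d in \<open>auto simp: entire_quot_def dist_commute\<close>)
    then show ?thesis
      using d(1) by (intro holomorphic_on_imp_differentiable_at[of _ "ball z d"]) auto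
  next
    case True
    \<comment> \<open>Both functions are divided by the common factor \<open>w - z\<close>.\<close>
    define F where "F w = (if w = z then deriv f z else f w / (w - z))" for w
    define G where "G w = (if w = z then deriv g z else g w / (w - z))" for w
    have F: "F holomorphic_on UNIV"
      by (rule pole_theorem_open_0[OF f open_UNIV, of z]) (use zero[OF True] in \<open>auto simp: F_def\<close>)
    have G: "G holomorphic_on UNIV"
      by (rule pole_theorem_open_0[OF g open_UNIV, of z]) (use True in \<open>auto simp: G_def\<close>)
    have "G z \<noteq> 0" using zero[OF True] by (simp add: G_def)
    then obtain d where d: "d > 0" "\<And>w. dist w z < d \<Longrightarrow> G w \<noteq> 0"
      using continuous_at_avoid[OF cont[OF G]] by (metis dist_commute)
    have "(\<lambda>w. F w / G w) holomorphic_on ball z d"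
      using d by (intro holomorphic_on_divide holomorphic_on_subset[OF F] holomorphic_on_subset[OF G])
        (auto simp: dist_commute)
    moreover have "F w / G w = entire_quot f g w" if "w \<in> ball z d" for w
    proof (cases "w = z")
      case False
      then have "g w \<noteq> 0" using d(2)[of w] that by (auto simp: G_def dist_commute)
      then show ?thesis using False by (simp add: F_def G_def entire_quot_def)
    qed (use True in \<open>simp add: F_def G_def entire_quot_def\<close>)
    ultimately have "entire_quot f g holomorphic_on ball z d"
      by (rule holomorphic_transform)
    then show ?thesis
      using d(1) by (intro holomorphic_on_imp_differentiable_at[of _ "ball z d"]) auto
  qed
  then show ?thesis
    by (simp add: holomorphic_on_def)
qed

lemma entire_quot_periodic:
  assumes f: "f holomorphic_on UNIV" and g: "g holomorphic_on UNIV" and u: "u holomorphic_on UNIV"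
    and zero: "\<And>z. g z = 0 \<Longrightarrow> f z = 0"
    and fu: "\<And>z. f (z + \<omega>) = u z * f z" and gu: "\<And>z. g (z + \<omega>) = u z * g z"
    and nz: "\<And>z. u z \<noteq> 0"
  shows "entire_quot f g (z + \<omega>) = entire_quot f g z"
proof (cases "g z = 0")
  case True
  have deriv: "deriv h (z + \<omega>) = u z * deriv h z"
    if h: "h holomorphic_on UNIV" and hu: "\<And>z. h (z + \<omega>) = u z * h z" and "h z = 0" for h
  proof -
    have dh: "(h has_field_derivative deriv h w) (at w)" for w
      using h by (intro holomorphic_derivI[of _ UNIV]) auto
    have du: "(u has_field_derivative deriv u z) (at z)"
      using u by (intro holomorphic_derivI[of _ UNIV]) auto
    have "((\<lambda>z. h (z + \<omega>)) has_field_derivative deriv h (z + \<omega>)) (at z)"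
      using dh[of "z + \<omega>"] DERIV_shift by blast
    moreover have "((\<lambda>z. h (z + \<omega>)) has_field_derivative deriv u z * h z + deriv h z * u z) (at z)"
      unfolding hu by (rule DERIV_mult[OF du dh])
    ultimately have "deriv h (z + \<omega>) = deriv u z * h z + deriv h z * u z"
      by (rule DERIV_unique)
    then show ?thesis using \<open>h z = 0\<close> by simp
  qed
  have "g (z + \<omega>) = 0" by (simp add: gu True)
  then show ?thesis
    using deriv[OF f fu zero[OF True]] deriv[OF g gu True] nz[of z] True
    by (simp add: entire_quot_def)
next
  case False
  then show ?thesis using nz[of z] by (simp add: entire_quot_def fu gu)
qed

lemma elliptic_entire_constant:
  assumes hol: "r holomorphic_on UNIV" and "Im \<tau> > 0"
    and p1: "\<And>z. r (z + 1) = r z" and p2: "\<And>z. r (z + \<tau>) = r z"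
  shows "r constant_on UNIV"
proof (rule Liouville_theorem[OF hol])
  interpret p1: periodic_fun_simple r 1 by standard (rule p1)
  interpret p2: periodic_fun_simple r \<tau> by standard (rule p2)
  define K where "K = (\<lambda>(s, t). of_real s * \<tau> + of_real t :: complex) ` ({0..1} \<times> {0..1 :: real})"
  have "compact K" unfolding K_def
    by (intro compact_continuous_image compact_Times compact_Icc)
       (auto simp: case_prod_unfold intro!: continuous_intros)
  then have "compact (r ` K)"
    by (rule compact_continuous_image[OF continuous_on_subset[OF holomorphic_on_imp_continuous_on[OF hol]], rotated]) simp
  moreover have "range r \<subseteq> r ` K"
  proof safe
    fix z
      \<comment> \<open>Reduction of \<open>z\<close> to the closed fundamental parallelogram.\<close>
  define s where "s = Im z / Im \<tau>"
    define t where "t = Re z - s * Re \<tau>"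
    have z: "z = of_real s * \<tau> + of_real t"
      using \<open>Im \<tau> > 0\<close> by (simp add: complex_eq_iff s_def t_def)
    define z0 where "z0 = of_real (frac s) * \<tau> + of_real (frac t)"
    have "z = z0 + of_int \<lfloor>s\<rfloor> * \<tau> + of_int \<lfloor>t\<rfloor> * 1"
      by (simp add: z z0_def frac_def algebra_simps)
    then have "r z = r z0" by (simp only: p1.plus_of_int p2.plus_of_int)
    moreover have "z0 \<in> K"
      unfolding K_def z0_def by (rule image_eqI[of _ _ "(frac s, frac t)"]) (auto simp: frac_lt_1 less_imp_le)
    ultimately show "r z \<in> r ` K" by blast
  qed
  ultimately show "bounded (range r)"
    using compact_imp_bounded bounded_subset by blast
qed

lemma quasi_periodic_proportional:
  assumes f: "f holomorphic_on UNIV" and g: "g holomorphic_on UNIV" and "Im \<tau> > 0"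
    and zero: "\<And>z. g z = 0 \<Longrightarrow> f z = 0 \<and> deriv g z \<noteq> 0"
    and u: "u holomorphic_on UNIV" "\<And>z. u z \<noteq> 0" and v: "v holomorphic_on UNIV" "\<And>z. v z \<noteq> 0"
    and "\<And>z. f (z + 1) = u z * f z" "\<And>z. g (z + 1) = u z * g z"
    and "\<And>z. f (z + \<tau>) = v z * f z" "\<And>z. g (z + \<tau>) = v z * g z"
  obtains C where "\<And>z. f z = C * g z"
proof -
  have zero': "f z = 0" if "g z = 0" for z using zero[OF that] by simp
  have "entire_quot f g constant_on UNIV"
  proof (rule elliptic_entire_constant[OF entire_quot_holomorphic[OF f g zero] \<open>Im \<tau> > 0\<close>])
    show "entire_quot f g (z + 1) = entire_quot f g z" for z
      using assms by (intro entire_quot_periodic[OF f g u(1) zero']) auto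
    show "entire_quot f g (z + \<tau>) = entire_quot f g z" for z
      using assms by (intro entire_quot_periodic[OF f g v(1) zero']) auto
  qed
  then obtain C where C: "\<And>z. entire_quot f g z = C" by (auto simp: constant_on_def)
  have "f z = C * g z" for z
    using C[of z] zero[of z] by (auto simp: entire_quot_def field_simps split: if_splits)
  then show ?thesis by (rule that)
qed

section \<open>Modular transformation of theta and eta\<close>

lemma e1_add_of_int [simp]: "e1 (x + of_int n) = e1 x"
  using e1_eq_1_iff[of "of_int n"] by (simp add: e1_add)

lemma jacobi_theta_shift:
  assumes "Im \<tau> > 0"
  shows "jacobi_theta \<tau> (z + of_int x * \<tau> + of_int y) =
    e1 (- (of_int x ^ 2 * \<tau> + 2 * of_int x * z + of_int x + of_int y) / 2) * jacobi_theta \<tau> z"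
proof -
  have "- of_real pi * \<i> * (of_int x ^ 2 * \<tau> + 2 * of_int x * z + of_int x + of_int y) =
      2 * of_real pi * \<i> * (- (of_int x ^ 2 * \<tau> + 2 * of_int x * z + of_int x + of_int y) / 2)"
    by (simp add: algebra_simps)
  then show ?thesis unfolding jacobi_theta_elliptic[OF assms] e1_def by (simp only:)
qed

lemma jacobi_theta_DERIV:
  assumes "Im \<tau> > 0"
  shows "(jacobi_theta \<tau> has_field_derivative theta_deriv 1 \<tau> z) (at z)"
  unfolding jacobi_theta_eq[abs_def] using theta_deriv_DERIV_z[OF DERIV_ident assms, of 0] by simp

lemma jacobi_theta_holomorphic:
  assumes "Im \<tau> > 0"
  shows "jacobi_theta \<tau> holomorphic_on UNIV"
  using jacobi_theta_DERIV[OF assms] by (auto simp: holomorphic_on_def field_differentiable_def)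

lemma holomorphic_on_e1 [holomorphic_intros]:
  "f holomorphic_on A \<Longrightarrow> (\<lambda>x. e1 (f x)) holomorphic_on A"
  unfolding e1_def by (intro holomorphic_intros)

lemma e1_DERIV [derivative_intros]:
  "(g has_field_derivative g') (at z within A) \<Longrightarrow>
    ((\<lambda>z. e1 (g z)) has_field_derivative 2 * of_real pi * \<i> * g' * e1 (g z)) (at z within A)"
  unfolding e1_def by (auto intro!: derivative_eq_intros)

lemma theta_deriv_1_0_nonzero:
  assumes "Im \<tau> > 0"
  shows "theta_deriv 1 \<tau> 0 \<noteq> 0"
  unfolding theta_deriv_1_0[OF assms] using dedekind_eta_nonzero[OF assms] by simp

lemma jacobi_theta_simple_zero:
  assumes "Im \<tau> > 0" "jacobi_theta \<tau> z = 0"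
  shows "theta_deriv 1 \<tau> z \<noteq> 0"
proof -
  obtain m n :: int where z: "z = 0 + of_int m * \<tau> + of_int n"
    using assms jacobi_theta_zero_iff by auto
  define u where "u w = e1 (- (of_int m ^ 2 * \<tau> + 2 * of_int m * w + of_int m + of_int n) / 2)" for w
  have "u holomorphic_on UNIV" unfolding u_def by (intro holomorphic_intros) auto
  then have du: "(u has_field_derivative deriv u 0) (at 0)"
    by (intro holomorphic_derivI[of _ UNIV]) auto
  have "((\<lambda>w. jacobi_theta \<tau> (w + of_int m * \<tau> + of_int n)) has_field_derivative
      deriv u 0 * jacobi_theta \<tau> 0 + theta_deriv 1 \<tau> 0 * u 0) (at 0)"
    unfolding jacobi_theta_shift[OF assms(1)] u_def[symmetric]
    by (rule DERIV_mult[OF du jacobi_theta_DERIV[OF assms(1)]])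
  moreover have "((\<lambda>w. jacobi_theta \<tau> (w + of_int m * \<tau> + of_int n)) has_field_derivative
      theta_deriv 1 \<tau> (0 + of_int m * \<tau> + of_int n) * 1) (at 0)"
    by (rule DERIV_chain2[OF jacobi_theta_DERIV[OF assms(1)]]) (auto intro!: derivative_eq_intros)
  ultimately have "theta_deriv 1 \<tau> z = deriv u 0 * jacobi_theta \<tau> 0 + theta_deriv 1 \<tau> 0 * u 0"
    unfolding z by (metis DERIV_unique mult.right_neutral)
  moreover have "jacobi_theta \<tau> 0 = 0" using jacobi_theta_odd[of \<tau> 0] by simp
  ultimately show ?thesis
    using theta_deriv_1_0_nonzero[OF assms(1)] by (simp add: u_def)
qed

text \<open>The Moebius action of an integral matrix with determinant 1, given by its entries, and its
  automorphy factor \<open>j\<close>.\<close>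
locale sl2_action =
  fixes a b c d :: int
  assumes det: "a * d - b * c = 1"
begin

definition j :: "complex \<Rightarrow> complex" where
  "j \<tau> = of_int c * \<tau> + of_int d"

definition act :: "complex \<Rightarrow> complex" where
  "act \<tau> = (of_int a * \<tau> + of_int b) / j \<tau>"

lemma det_complex: "of_int a * of_int d - of_int b * of_int c = (1 :: complex)"
  using det by (metis of_int_1 of_int_diff of_int_mult)

lemma j_nonzero:
  assumes "Im \<tau> > 0"
  shows "j \<tau> \<noteq> 0"
proof
  assume "j \<tau> = 0"
  then have "of_int c * Im \<tau> = 0" "of_int c * Re \<tau> + of_int d = 0"
    by (simp_all add: j_def complex_eq_iff)
  then have "c = 0" "d = 0" using assms by auto
  then show False using det by simp
qed

lemma Im_act:
  assumes "Im \<tau> > 0"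
  shows "Im (act \<tau>) > 0"
proof -
  have "Im (act \<tau>) = Im ((of_int a * \<tau> + of_int b) * cnj (j \<tau>)) / (cmod (j \<tau>)) ^ 2"
    unfolding act_def by (simp add: Im_complex_div_eq_0 complex_div_cnj[of _ "j \<tau>"])
  also have "Im ((of_int a * \<tau> + of_int b) * cnj (j \<tau>)) = of_int (a * d - b * c) * Im \<tau>"
    by (simp add: j_def algebra_simps)
  finally show ?thesis using assms j_nonzero[OF assms] by (simp add: det)
qed

lemma inverse_j:
  assumes "Im \<tau> > 0"
  shows "1 / j \<tau> = - of_int c * act \<tau> + of_int a"
proof -
  have "1 = - of_int c * (of_int a * \<tau> + of_int b) + of_int a * j \<tau>"
    using det_complex by (simp add: j_def algebra_simps)
  then show ?thesis using j_nonzero[OF assms] by (simp add: act_def field_simps)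
qed

lemma tau_over_j:
  assumes "Im \<tau> > 0"
  shows "\<tau> / j \<tau> = of_int d * act \<tau> - of_int b"
proof -
  have "\<tau> * (of_int a * of_int d - of_int b * of_int c) = of_int d * (of_int a * \<tau> + of_int b) - of_int b * j \<tau>"
    by (simp add: j_def algebra_simps)
  then show ?thesis using j_nonzero[OF assms] by (simp add: det_complex act_def field_simps)
qed

text \<open>The two parity facts make the signs of theta under the transformed periods equal to those
  under the original ones: no column of the matrix is even.\<close>
lemma parity1: "even ((c + 1) * (a - 1))"
  using det by (metis dvd_diff dvd_mult dvd_mult2 even_add even_diff even_mult_iff odd_one)

lemma parity2: "even ((b + 1) * (d - 1))"
  using det by (metis dvd_diff dvd_mult dvd_mult2 even_add even_diff even_mult_iff odd_one)

text \<open>In the new coordinate \<open>z / j\<close> the periods \<open>1\<close> and \<open>\<tau>\<close> become \<open>- c T + a\<close> and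
  \<open>d T - b\<close>, where \<open>T\<close> is the image of \<open>\<tau>\<close>.\<close>
lemma theta_act_exists:
  assumes \<tau>: "Im \<tau> > 0"
  obtains C where "\<And>z. jacobi_theta (act \<tau>) (z / j \<tau>) = C * (e1 (of_int c * z ^ 2 / (2 * j \<tau>)) * jacobi_theta \<tau> z)"
proof -
  note jn = j_nonzero[OF \<tau>] and \<tau>' = Im_act[OF \<tau>]
  define J where "J = j \<tau>"
  define T where "T = act \<tau>"
  have J: "J \<noteq> 0" using jn by (simp add: J_def)
  have T: "Im T > 0" using \<tau>' by (simp add: T_def)
  define \<gamma> where "\<gamma> = (of_int c :: complex)"
  \<comment> \<open>The Gaussian factor turns the periods of the transformed theta function into those of the original one.\<close>
  define f where "f z = jacobi_theta T (z / J) * e1 (- (\<gamma> * z ^ 2 / (2 * J)))" for z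
  have hf: "f holomorphic_on UNIV"
  proof -
    have "(\<lambda>z. jacobi_theta T (z / J)) holomorphic_on UNIV"
      by (rule holomorphic_on_compose_gen[OF _ jacobi_theta_holomorphic[OF T], unfolded o_def])
         (auto intro!: holomorphic_intros simp: J)
    then show ?thesis unfolding f_def by (intro holomorphic_intros) (auto simp: J)
  qed
  have f1: "f (z + 1) = e1 (- (1 / 2)) * f z" for z
  proof -
    obtain k where k: "(c + 1) * (a - 1) = 2 * k" using parity1 by blast
    have k': "(of_int c + 1) * (of_int a - 1) = 2 * (of_int k :: complex)"
      using arg_cong[OF k, of "of_int :: int \<Rightarrow> complex"] by simp
    have eq: "(z + 1) / J = z / J + of_int (- c) * T + of_int a"
      using inverse_j[OF \<tau>] unfolding J_def[symmetric] T_def[symmetric] by (simp add: add_divide_distrib)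
    have 1: "\<gamma> * (1 / J) = \<gamma> * (- \<gamma> * T + of_int a)"
      using inverse_j[OF \<tau>] unfolding J_def[symmetric] T_def[symmetric] \<gamma>_def by simp
    let ?X = "- (of_int (- c) ^ 2 * T + 2 * of_int (- c) * (z / J) + of_int (- c) + of_int a) / 2
        + - (\<gamma> * (z + 1) ^ 2 / (2 * J))"
    have "?X =
       - (\<gamma> * z ^ 2 / (2 * J)) - (\<gamma> * \<gamma> * T + \<gamma> * (1 / J) - \<gamma> + of_int a) / 2"
      using J by (simp add: \<gamma>_def power2_eq_square field_simps)
    also have "\<dots> = (- (1 / 2) + - (\<gamma> * z ^ 2 / (2 * J))) + of_int (- k)"
      unfolding 1 using k' unfolding \<gamma>_def[symmetric] by (simp add: field_simps)
    finally have exponent: "?X = (- (1 / 2) + - (\<gamma> * z ^ 2 / (2 * J))) + of_int (- k)" .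
    have "f (z + 1) = e1 ?X * jacobi_theta T (z / J)"
      unfolding f_def eq jacobi_theta_shift[OF T] e1_add by (simp only: mult_ac)
    also have "\<dots> = e1 (- (1 / 2) + - (\<gamma> * z ^ 2 / (2 * J))) * jacobi_theta T (z / J)"
      unfolding exponent e1_add_of_int ..
    finally show ?thesis
      unfolding f_def e1_add by (simp only: mult_ac)
  qed
  have f2: "f (z + \<tau>) = e1 (- (\<tau> + 2 * z + 1) / 2) * f z" for z
  proof -
    obtain k where k: "(b + 1) * (d - 1) = 2 * k" using parity2 by blast
    have k': "(of_int b + 1) * (of_int d - 1) = 2 * (of_int k :: complex)"
      using arg_cong[OF k, of "of_int :: int \<Rightarrow> complex"] by simp
    have bd: "of_int b * of_int d = 2 * of_int k + 1 + of_int b - (of_int d :: complex)"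
      using k' by (simp add: algebra_simps)
    have 1: "\<tau> / J = of_int d * T - of_int b"
      using tau_over_j[OF \<tau>] unfolding J_def[symmetric] T_def[symmetric] .
    have eq: "(z + \<tau>) / J = z / J + of_int d * T + of_int (- b)"
      by (simp add: add_divide_distrib 1)
    have JJ: "\<gamma> * \<tau> + of_int d = J" by (simp add: J_def j_def \<gamma>_def)
    have T1: "J * T = of_int a * \<tau> + of_int b" using J by (simp add: T_def act_def J_def)
    have "of_int d ^ 2 * T + \<gamma> * \<tau> * (\<tau> / J) = of_int d * (T * (\<gamma> * \<tau> + of_int d)) - of_int b * \<gamma> * \<tau>"
      unfolding 1 by (simp add: algebra_simps power2_eq_square)
    also have "\<dots> = \<tau> * (of_int a * of_int d - of_int b * \<gamma>) + of_int b * of_int d"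
      unfolding JJ using T1 by (simp add: mult.commute[of T] algebra_simps)
    finally have 2: "of_int d ^ 2 * T + \<gamma> * \<tau> * (\<tau> / J) = \<tau> + of_int b * of_int d"
      unfolding \<gamma>_def det_complex by simp
    have 3: "of_int d * (z / J) + \<gamma> * z * \<tau> / J = z"
    proof -
      have "of_int d * (z / J) + \<gamma> * z * \<tau> / J = z * (\<gamma> * \<tau> + of_int d) / J"
        using J by (simp add: field_simps)
      then show ?thesis using J by (simp add: JJ)
    qed
    let ?X = "- (of_int d ^ 2 * T + 2 * of_int d * (z / J) + of_int d + of_int (- b)) / 2
        + - (\<gamma> * (z + \<tau>) ^ 2 / (2 * J))"
    have "?X =
       - (\<gamma> * z ^ 2 / (2 * J)) - ((of_int d ^ 2 * T + \<gamma> * \<tau> * (\<tau> / J)) +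
         2 * (of_int d * (z / J) + \<gamma> * z * \<tau> / J) + of_int d - of_int b) / 2"
      using J by (simp add: power2_eq_square field_simps)
    also have "\<dots> = (- (\<tau> + 2 * z + 1) / 2 + - (\<gamma> * z ^ 2 / (2 * J))) + of_int (- k)"
      unfolding 2 3 bd by (simp add: field_simps)
    finally have exponent: "?X = (- (\<tau> + 2 * z + 1) / 2 + - (\<gamma> * z ^ 2 / (2 * J))) + of_int (- k)" .
    have "f (z + \<tau>) = e1 ?X * jacobi_theta T (z / J)"
      unfolding f_def eq jacobi_theta_shift[OF T] e1_add by (simp only: mult_ac)
    also have "\<dots> = e1 (- (\<tau> + 2 * z + 1) / 2 + - (\<gamma> * z ^ 2 / (2 * J))) * jacobi_theta T (z / J)"
      unfolding exponent e1_add_of_int ..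
    finally show ?thesis
      unfolding f_def e1_add by (simp only: mult_ac)
  qed
  have g1: "jacobi_theta \<tau> (z + 1) = e1 (- (1 / 2)) * jacobi_theta \<tau> z" for z
    using jacobi_theta_shift[OF \<tau>, of z 0 1] by simp
  have g2: "jacobi_theta \<tau> (z + \<tau>) = e1 (- (\<tau> + 2 * z + 1) / 2) * jacobi_theta \<tau> z" for z
    using jacobi_theta_shift[OF \<tau>, of z 1 0] by simp
  have zero: "f z = 0 \<and> deriv (jacobi_theta \<tau>) z \<noteq> 0" if zero: "jacobi_theta \<tau> z = 0" for z
  proof
    obtain m n :: int where z: "z = of_int m * \<tau> + of_int n"
      using jacobi_theta_zero_iff[OF \<tau>, of z] zero by auto
    have "z / J = of_int m * (\<tau> / J) + of_int n * (1 / J)"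
      by (simp add: z add_divide_distrib)
    also have "\<dots> = of_int (m * d - n * c) * T + of_int (n * a - m * b)"
      unfolding J_def inverse_j[OF \<tau>] tau_over_j[OF \<tau>] T_def[symmetric]
      by (simp add: algebra_simps)
    finally have "jacobi_theta T (z / J) = 0" using jacobi_theta_zero_iff[OF T] by blast
    then show "f z = 0" by (simp add: f_def)
    show "deriv (jacobi_theta \<tau>) z \<noteq> 0"
      using jacobi_theta_simple_zero[OF \<tau> zero] DERIV_imp_deriv[OF jacobi_theta_DERIV[OF \<tau>]] by simp
  qed
  obtain C where C: "\<And>z. f z = C * jacobi_theta \<tau> z"
  proof (rule quasi_periodic_proportional[OF hf jacobi_theta_holomorphic[OF \<tau>] \<tau> zero,
        where u = "\<lambda>_. e1 (- (1 / 2))" and v = "\<lambda>z. e1 (- (\<tau> + 2 * z + 1) / 2)"])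
  qed (rule holomorphic_intros e1_nonzero f1 f2 g1 g2 that | assumption | simp)+
  have "jacobi_theta T (z / J) = f z * e1 (\<gamma> * z ^ 2 / (2 * J))" for z
    by (simp add: f_def flip: e1_add)
  then have "jacobi_theta T (z / J) = C * (e1 (\<gamma> * z ^ 2 / (2 * J)) * jacobi_theta \<tau> z)" for z
    by (simp add: C)
  then show ?thesis
    by (intro that[of C]) (simp add: T_def J_def \<gamma>_def)
qed

text \<open>The factor of proportionality between the two theta functions, read off from their
  derivatives at \<open>z = 0\<close>.\<close>
definition mult_factor :: "complex \<Rightarrow> complex" where
  "mult_factor \<tau> = theta_deriv 1 (act \<tau>) 0 / (j \<tau> * theta_deriv 1 \<tau> 0)"

lemma
  assumes \<tau>: "Im \<tau> > 0"
  shows theta_act: "jacobi_theta (act \<tau>) (z / j \<tau>) =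
      mult_factor \<tau> * (e1 (of_int c * z ^ 2 / (2 * j \<tau>)) * jacobi_theta \<tau> z)"
    and theta_deriv_3_act: "theta_deriv 3 (act \<tau>) 0 / j \<tau> ^ 3 =
      mult_factor \<tau> * (theta_deriv 3 \<tau> 0 + 6 * (of_real pi * \<i> * of_int c / j \<tau>) * theta_deriv 1 \<tau> 0)"
proof -
  note jn = j_nonzero[OF \<tau>] and \<tau>' = Im_act[OF \<tau>]
  obtain C where C: "\<And>z. jacobi_theta (act \<tau>) (z / j \<tau>) = C * (e1 (of_int c * z ^ 2 / (2 * j \<tau>)) * jacobi_theta \<tau> z)"
    using theta_act_exists[OF \<tau>] by blast
  define \<gamma> where "\<gamma> = of_real pi * \<i> * of_int c / j \<tau>"
  define E where "E z = exp (\<gamma> * z ^ 2)" for z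
  define L where "L k z = theta_deriv k (act \<tau>) (z / j \<tau>) / j \<tau> ^ k" for k z
  define G where "G k z = theta_deriv k \<tau> z" for k z
  have dE: "(E has_field_derivative 2 * \<gamma> * z * E z) (at z)" for z
    unfolding E_def by (auto intro!: derivative_eq_intros simp: power2_eq_square)
  have dL: "(L k has_field_derivative L (Suc k) z) (at z)" for k z
    unfolding L_def using jn \<tau>' by (auto intro!: derivative_eq_intros)
  have dG: "(G k has_field_derivative G (Suc k) z) (at z)" for k z
    unfolding G_def using \<tau> by (auto intro!: derivative_eq_intros)
  have step: "L (Suc k) z = C * (E z * (Q' + 2 * \<gamma> * z * Q z))"
    if eq: "\<And>z. L k z = C * (E z * Q z)" and Q: "(Q has_field_derivative Q') (at z)" for k Q Q' z
  proof -
    have "((\<lambda>z. C * (E z * Q z)) has_field_derivative C * (2 * \<gamma> * z * E z * Q z + Q' * E z)) (at z)"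
      by (intro DERIV_cmult DERIV_mult dE Q)
    moreover have "((\<lambda>z. C * (E z * Q z)) has_field_derivative L (Suc k) z) (at z)"
      using dL[of k z] by (rule DERIV_cong_ev[THEN iffD1, rotated -1]) (auto simp: eq)
    ultimately have "C * (2 * \<gamma> * z * E z * Q z + Q' * E z) = L (Suc k) z"
      by (rule DERIV_unique)
    then show ?thesis by (simp add: algebra_simps)
  qed
  \<comment> \<open>The Gaussian factor \<open>E\<close> is split off from each derivative; only its value at 0 is needed in the end.\<close>
  define Q1 where "Q1 z = G 1 z + 2 * \<gamma> * z * G 0 z" for z
  define Q2 where "Q2 z = (G 2 z + 2 * \<gamma> * (G 0 z + z * G 1 z)) + 2 * \<gamma> * z * Q1 z" for z
  have 0: "L 0 z = C * (E z * G 0 z)" for z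
    using C[of z] by (simp add: L_def G_def E_def jacobi_theta_eq e1_def \<gamma>_def mult_ac)
  have 1: "L 1 z = C * (E z * Q1 z)" for z
    using step[OF 0 dG] by (simp add: Q1_def)
  have 2: "L 2 z = C * (E z * Q2 z)" for z
  proof -
    have "(Q1 has_field_derivative G 2 z + 2 * \<gamma> * (G 0 z + z * G 1 z)) (at z)"
      unfolding Q1_def using dG[of 1] dG[of 0]
      by (auto intro!: derivative_eq_intros simp: numeral_2_eq_2 algebra_simps)
    from step[OF 1 this] show ?thesis by (simp add: Q2_def numeral_2_eq_2)
  qed
  have 3: "L 3 0 = C * (G 3 0 + 6 * \<gamma> * G 1 0)"
  proof -
    have "(Q1 has_field_derivative G 2 0 + 2 * \<gamma> * G 0 0) (at 0)"
      unfolding Q1_def using dG[of 1] dG[of 0]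
      by (auto intro!: derivative_eq_intros simp: numeral_2_eq_2)
    moreover have "Q1 0 = G 1 0" by (simp add: Q1_def)
    ultimately have "(Q2 has_field_derivative G 3 0 + 6 * \<gamma> * G 1 0) (at 0)"
      unfolding Q2_def using dG[of 2] dG[of 1] dG[of 0]
      by (auto intro!: derivative_eq_intros simp: numeral_3_eq_3 numeral_2_eq_2)
    from step[OF 2 this] show ?thesis by (simp add: E_def numeral_3_eq_3)
  qed
  have CC: "C = mult_factor \<tau>"
    using 1[of 0] jn theta_deriv_1_0_nonzero[OF \<tau>]
    by (simp add: L_def G_def E_def Q1_def mult_factor_def field_simps)
  show "jacobi_theta (act \<tau>) (z / j \<tau>) =
      mult_factor \<tau> * (e1 (of_int c * z ^ 2 / (2 * j \<tau>)) * jacobi_theta \<tau> z)"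
    using C CC by simp
  show "theta_deriv 3 (act \<tau>) 0 / j \<tau> ^ 3 =
      mult_factor \<tau> * (theta_deriv 3 \<tau> 0 + 6 * (of_real pi * \<i> * of_int c / j \<tau>) * theta_deriv 1 \<tau> 0)"
    using 3 by (simp add: L_def G_def CC \<gamma>_def)
qed

lemma j_DERIV: "(j has_field_derivative of_int c) (at \<tau>)"
  unfolding j_def by (auto intro!: derivative_eq_intros)

lemma act_DERIV:
  assumes "Im \<tau> > 0"
  shows "(act has_field_derivative 1 / j \<tau> ^ 2) (at \<tau>)"
proof -
  have "(act has_field_derivative (of_int a * j \<tau> - (of_int a * \<tau> + of_int b) * of_int c) / (j \<tau> * j \<tau>)) (at \<tau>)"
    unfolding act_def using j_nonzero[OF assms] by (auto intro!: derivative_eq_intros j_DERIV)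
  moreover have "of_int a * j \<tau> - (of_int a * \<tau> + of_int b) * of_int c = 1"
    using det_complex by (simp add: j_def algebra_simps)
  ultimately show ?thesis by (simp add: power2_eq_square)
qed

text \<open>The derivatives in \<open>\<tau>\<close> of both theta derivatives are third derivatives in \<open>z\<close>, whose
  transformation law is already known; they cancel and leave a linear differential equation.\<close>
lemma mult_factor_DERIV:
  assumes \<tau>: "Im \<tau> > 0"
  shows "(mult_factor has_field_derivative of_int c / (2 * j \<tau>) * mult_factor \<tau>) (at \<tau>)"
proof -
  note jn = j_nonzero[OF \<tau>] and \<tau>' = Im_act[OF \<tau>] and nz = theta_deriv_1_0_nonzero[OF \<tau>]
  define D where "D = theta_deriv 1 \<tau> 0"
  define D' where "D' = theta_deriv 1 (act \<tau>) 0"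
  define K where "K = theta_deriv 3 \<tau> 0"
  define K' where "K' = theta_deriv 3 (act \<tau>) 0"
  define p where "p = of_real pi * \<i>"
  have nzs: "D \<noteq> 0" "p \<noteq> 0" using nz by (simp_all add: D_def p_def)
  have C: "D' = mult_factor \<tau> * j \<tau> * D"
    using jn nz by (simp add: mult_factor_def D_def D'_def)
  have "K' / j \<tau> ^ 3 = mult_factor \<tau> * (K + 6 * (p * of_int c / j \<tau>) * D)"
    using theta_deriv_3_act[OF \<tau>] by (simp add: K_def K'_def D_def p_def)
  then have K': "K' = j \<tau> ^ 3 * (mult_factor \<tau> * (K + 6 * (p * of_int c / j \<tau>) * D))"
    using jn by (simp add: field_simps)
  have "((\<lambda>\<tau>. theta_deriv 1 (act \<tau>) 0) has_field_derivative
      theta_deriv (1 + 2) (act \<tau>) 0 / (4 * of_real pi * \<i>) * (1 / j \<tau> ^ 2)) (at \<tau>)"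
    by (rule theta_deriv_DERIV_tau[OF act_DERIV[OF \<tau>] \<tau>'])
  then have d1: "((\<lambda>\<tau>. theta_deriv 1 (act \<tau>) 0) has_field_derivative K' / (4 * p) * (1 / j \<tau> ^ 2)) (at \<tau>)"
    by (simp add: K'_def p_def numeral_3_eq_3 mult.assoc)
  have "((\<lambda>\<tau>. theta_deriv 1 \<tau> 0) has_field_derivative
      theta_deriv (1 + 2) \<tau> 0 / (4 * of_real pi * \<i>) * 1) (at \<tau>)"
    by (rule theta_deriv_DERIV_tau[OF DERIV_ident \<tau>])
  then have d2: "((\<lambda>\<tau>. theta_deriv 1 \<tau> 0) has_field_derivative K / (4 * p)) (at \<tau>)"
    by (simp add: K_def p_def numeral_3_eq_3 mult.assoc)
  have "(mult_factor has_field_derivative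
     (K' / (4 * p) * (1 / j \<tau> ^ 2) * (j \<tau> * D) - D' * (of_int c * D + K / (4 * p) * j \<tau>)) / ((j \<tau> * D) * (j \<tau> * D))) (at \<tau>)"
    unfolding mult_factor_def D_def D'_def
    by (rule DERIV_divide[OF d1 DERIV_mult[OF j_DERIV d2]]) (use jn nz in simp)
  also have "(K' / (4 * p) * (1 / j \<tau> ^ 2) * (j \<tau> * D) - D' * (of_int c * D + K / (4 * p) * j \<tau>)) / ((j \<tau> * D) * (j \<tau> * D))
     = of_int c / (2 * j \<tau>) * mult_factor \<tau>"
    unfolding K' C using jn nzs by (simp add: field_simps power2_eq_square power3_eq_cube)
  finally show ?thesis .
qed

lemma mult_factor_square:
  obtains k where "\<And>\<tau>. Im \<tau> > 0 \<Longrightarrow> mult_factor \<tau> ^ 2 = k * j \<tau>"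
proof -
  have "\<exists>k. \<forall>\<tau>\<in>{\<tau>. Im \<tau> > 0}. mult_factor \<tau> ^ 2 / j \<tau> = k"
  proof (rule has_field_derivative_zero_constant)
    show "convex {\<tau>. Im \<tau> > 0}" by (rule convex_halfspace_Im_gt)
    fix \<tau> :: complex assume "\<tau> \<in> {\<tau>. Im \<tau> > 0}"
    then have \<tau>: "Im \<tau> > 0" by simp
    have "((\<lambda>\<tau>. mult_factor \<tau> ^ 2 / j \<tau>) has_field_derivative 0) (at \<tau>)"
      using j_nonzero[OF \<tau>]
      by (auto intro!: derivative_eq_intros mult_factor_DERIV[OF \<tau>] j_DERIV simp: power2_eq_square field_simps)
    then show "((\<lambda>\<tau>. mult_factor \<tau> ^ 2 / j \<tau>) has_field_derivative 0) (at \<tau> within {\<tau>. Im \<tau> > 0})"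
      by (rule has_field_derivative_at_within)
  qed
  then obtain k where k: "\<And>\<tau>. Im \<tau> > 0 \<Longrightarrow> mult_factor \<tau> ^ 2 / j \<tau> = k" by auto
  have "mult_factor \<tau> ^ 2 = k * j \<tau>" if "Im \<tau> > 0" for \<tau>
    using k[OF that] j_nonzero[OF that] by (simp add: field_simps)
  then show ?thesis by (rule that)
qed

lemma eta_act_cube:
  assumes "Im \<tau> > 0"
  shows "dedekind_eta (act \<tau>) ^ 3 = mult_factor \<tau> * j \<tau> * dedekind_eta \<tau> ^ 3"
proof -
  have "theta_deriv 1 (act \<tau>) 0 = mult_factor \<tau> * j \<tau> * theta_deriv 1 \<tau> 0"
    using j_nonzero[OF assms] theta_deriv_1_0_nonzero[OF assms] by (simp add: mult_factor_def)
  then show ?thesis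
    unfolding theta_deriv_1_0[OF assms] theta_deriv_1_0[OF Im_act[OF assms]] by simp
qed

end

lemma dedekind_eta_DERIV:
  assumes "Im \<tau> > 0"
  shows "\<exists>D. (dedekind_eta has_field_derivative D) (at \<tau>)"
proof -
  have 3: "Im (3 * \<tau>) > 0" using assms by simp
  let ?u = "theta_deriv (0 + 2) (3 * \<tau>) \<tau> / (4 * of_real pi * \<i>)" and ?v = "theta_deriv (0 + 1) (3 * \<tau>) \<tau>"
  have "((\<lambda>t. (\<lambda>(\<tau>, z). theta_deriv 0 \<tau> z) (3 * t, t)) has_derivative
      (\<lambda>h. (\<lambda>(h, l). ?u * h + ?v * l) (3 * h, h))) (at \<tau>)"
    by (rule has_derivative_compose[where f = "\<lambda>t. (3 * t, t)", OF _ theta_deriv_has_derivative[OF 3]])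
       (auto intro!: derivative_eq_intros)
  then have "((\<lambda>t. theta_deriv 0 (3 * t) t) has_field_derivative (3 * ?u + ?v)) (at \<tau>)"
    unfolding has_field_derivative_def case_prod_conv
    by (rule has_derivative_eq_rhs) (auto simp: fun_eq_iff algebra_simps)
  then have "((\<lambda>t. - e1 (t / 6) * jacobi_theta (3 * t) t) has_field_derivative
      - e1 (\<tau> / 6) * (3 * ?u + ?v) - (2 * of_real pi * \<i> / 6) * e1 (\<tau> / 6) * jacobi_theta (3 * \<tau>) \<tau>) (at \<tau>)"
    unfolding jacobi_theta_eq by (auto intro!: derivative_eq_intros)
  then have "(dedekind_eta has_field_derivative
      - e1 (\<tau> / 6) * (3 * ?u + ?v) - (2 * of_real pi * \<i> / 6) * e1 (\<tau> / 6) * jacobi_theta (3 * \<tau>) \<tau>) (at \<tau>)"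
    by (rule DERIV_cong_ev[THEN iffD1, OF refl _ refl, rotated])
       (auto intro!: eventually_mono[OF eventually_nhds_in_open[OF open_halfspace_Im_gt[of 0], of \<tau>]] simp: dedekind_eta_pentagonal assms)
  then show ?thesis by blast
qed

lemma isCont_dedekind_eta:
  assumes "Im \<tau> > 0"
  shows "isCont dedekind_eta \<tau>"
  using dedekind_eta_DERIV[OF assms] DERIV_isCont by blast

context sl2_action
begin

text \<open>For \<open>c \<noteq> 0\<close> the automorphy factor is not real, and for \<open>c = 0\<close> it is constant; so
  the principal branch never jumps.\<close>
lemma continuous_csqrt_j: "continuous_on {\<tau>. Im \<tau> > 0} (\<lambda>\<tau>. csqrt (j \<tau>))"
proof (cases "c = 0")
  case True
  have "csqrt (j \<tau>) = csqrt (of_int d)" for \<tau>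
    unfolding j_def unfolding True by simp
  then show ?thesis by simp
next
  case False
  have "isCont (\<lambda>\<tau>. csqrt (j \<tau>)) \<tau>" if "Im \<tau> > 0" for \<tau>
  proof (rule isCont_csqrt')
    show "isCont j \<tau>" unfolding j_def by (intro continuous_intros)
    show "j \<tau> \<notin> \<real>\<^sub>\<le>\<^sub>0"
      using that False by (auto simp: j_def complex_nonpos_Reals_iff)
  qed
  then show ?thesis by (auto intro!: continuous_at_imp_continuous_on)
qed

lemma eta_act:
  obtains v where "\<And>\<tau>. Im \<tau> > 0 \<Longrightarrow> dedekind_eta (act \<tau>) = v * csqrt (j \<tau>) * dedekind_eta \<tau>"
proof -
  let ?H = "{\<tau>. Im \<tau> > 0}"
  define h where "h \<tau> = dedekind_eta (act \<tau>) / (csqrt (j \<tau>) * dedekind_eta \<tau>)" for \<tau>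
  have nz: "csqrt (j \<tau>) * dedekind_eta \<tau> \<noteq> 0" if "Im \<tau> > 0" for \<tau>
    using j_nonzero[OF that] dedekind_eta_nonzero[OF that] by simp
  obtain k where k: "\<And>\<tau>. Im \<tau> > 0 \<Longrightarrow> mult_factor \<tau> ^ 2 = k * j \<tau>"
    using mult_factor_square by blast
  \<comment> \<open>The sixth power is expressible by the known cube of eta and by the square of \<open>mult_factor\<close>.\<close>
  have h6: "h \<tau> ^ 6 = k" if \<tau>: "Im \<tau> > 0" for \<tau>
  proof -
    define e where "e = dedekind_eta \<tau>"
    have e: "e \<noteq> 0" using dedekind_eta_nonzero[OF \<tau>] by (simp add: e_def)
    have s: "csqrt (j \<tau>) ^ 6 = j \<tau> ^ 3"
      using power_mult[of "csqrt (j \<tau>)" 2 3] by simp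
    have "dedekind_eta (act \<tau>) ^ 6 = (dedekind_eta (act \<tau>) ^ 3) ^ 2" by (simp flip: power_mult)
    also have "\<dots> = mult_factor \<tau> ^ 2 * j \<tau> ^ 2 * e ^ 6"
      unfolding eta_act_cube[OF \<tau>] by (simp add: power_mult_distrib e_def flip: power_mult)
    also have "\<dots> = k * j \<tau> ^ 3 * e ^ 6"
      unfolding k[OF \<tau>] by (simp add: power2_eq_square power3_eq_cube)
    finally show ?thesis
      using e j_nonzero[OF \<tau>] by (simp add: h_def power_divide power_mult_distrib s flip: e_def)
  qed
  have "h constant_on ?H"
  proof (rule continuous_finite_range_constant)
    show "connected ?H" by (intro convex_connected convex_halfspace_Im_gt)
    have "continuous_on ?H act"
      using act_DERIV DERIV_isCont by (auto intro!: continuous_at_imp_continuous_on)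
    then have "continuous_on ?H (\<lambda>\<tau>. dedekind_eta (act \<tau>))"
      by (rule continuous_on_compose2[rotated, of _ _ ?H])
         (auto intro!: continuous_at_imp_continuous_on isCont_dedekind_eta Im_act)
    then show "continuous_on ?H h"
      unfolding h_def using nz
      by (intro continuous_intros continuous_csqrt_j)
         (auto intro!: continuous_at_imp_continuous_on isCont_dedekind_eta)
    have "h ` ?H \<subseteq> {x. x ^ 6 = k}" using h6 by auto
    moreover have "finite {x :: complex. x ^ 6 = k}" by (rule finite_nth_roots) simp
    ultimately show "finite (h ` ?H)" by (rule finite_subset)
  qed
  then obtain v where v: "\<And>\<tau>. Im \<tau> > 0 \<Longrightarrow> h \<tau> = v" by (auto simp: constant_on_def)
  have "dedekind_eta (act \<tau>) = v * csqrt (j \<tau>) * dedekind_eta \<tau>" if "Im \<tau> > 0" for \<tau>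
    using v[OF that] nz[OF that] by (auto simp: h_def field_simps)
  then show ?thesis by (rule that)
qed

lemma mult_factor_eq:
  assumes "\<And>\<tau>. Im \<tau> > 0 \<Longrightarrow> dedekind_eta (act \<tau>) = v * csqrt (j \<tau>) * dedekind_eta \<tau>" "Im \<tau> > 0"
  shows "mult_factor \<tau> = v ^ 3 * csqrt (j \<tau>)"
proof -
  have "(v * csqrt (j \<tau>) * dedekind_eta \<tau>) ^ 3 = mult_factor \<tau> * j \<tau> * dedekind_eta \<tau> ^ 3"
    using eta_act_cube[OF assms(2)] unfolding assms(1)[OF assms(2)] .
  moreover have "csqrt (j \<tau>) ^ 3 = j \<tau> * csqrt (j \<tau>)"
    by (simp add: power3_eq_cube flip: power2_eq_square)
  ultimately show ?thesis
    using dedekind_eta_nonzero[OF assms(2)] j_nonzero[OF assms(2)]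
    by (simp add: power_mult_distrib)
qed

end

section \<open>Fourier expansion of the theta quark\<close>

lemma has_sum_product:
  fixes f :: "'a \<Rightarrow> complex" and g :: "'b \<Rightarrow> complex"
  assumes f: "(f has_sum F) A" and g: "(g has_sum G) B"
  shows "((\<lambda>(x, y). f x * g y) has_sum F * G) (A \<times> B)"
proof (rule has_sum_SigmaI[where g = "\<lambda>x. f x * G"])
  show "((\<lambda>y. case (x, y) of (x, y) \<Rightarrow> f x * g y) has_sum f x * G) B" for x
    using has_sum_cmult_right[OF g, of "f x"] by simp
  show "((\<lambda>x. f x * G) has_sum F * G) A"
    by (rule has_sum_cmult_left[OF f])
  have f': "(\<lambda>x. norm (f x)) summable_on A" and g': "(\<lambda>y. norm (g y)) summable_on B"
    using f g summable_on_iff_abs_summable_on_complex has_sum_imp_summable by blast+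
  have "(\<lambda>p. norm (case p of (x, y) \<Rightarrow> f x * g y)) summable_on (A \<times> B)"
  proof (rule summable_on_SigmaI)
    show "((\<lambda>y. norm (case (x, y) of (x, y) \<Rightarrow> f x * g y)) has_sum norm (f x) * infsum (\<lambda>y. norm (g y)) B) B" for x
      using has_sum_cmult_right[OF has_sum_infsum[OF g'], of "norm (f x)"] by (simp add: norm_mult)
    show "(\<lambda>x. norm (f x) * infsum (\<lambda>y. norm (g y)) B) summable_on A"
      by (rule summable_on_cmult_left[OF f'])
  qed simp
  then show "(\<lambda>(x, y). f x * g y) summable_on (A \<times> B)"
    by (rule abs_summable_summable)
qed

lemma has_sum_fibers:
  fixes f :: "'a \<Rightarrow> complex"
  assumes f: "(f has_sum S) X" and maps: "\<And>x. x \<in> X \<Longrightarrow> \<psi> x \<in> E"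
  shows "((\<lambda>e. infsum f {x \<in> X. \<psi> x = e}) has_sum S) E"
proof (rule has_sum_SigmaD)
  show "((\<lambda>(e, x). f x) has_sum S) (Sigma E (\<lambda>e. {x \<in> X. \<psi> x = e}))"
    using f
    by (subst has_sum_reindex_bij_witness[where S = "Sigma E (\<lambda>e. {x \<in> X. \<psi> x = e})" and T = X
          and i = "\<lambda>x. (\<psi> x, x)" and j = snd and h = f and s' = S])
       (auto intro: maps)
  show "((\<lambda>y. case (e, y) of (e, x) \<Rightarrow> f x) has_sum infsum f {x \<in> X. \<psi> x = e}) {x \<in> X. \<psi> x = e}" for e
    using summable_on_subset_banach[OF has_sum_imp_summable[OF f], of "{x \<in> X. \<psi> x = e}"] by auto
qed

text \<open>The negative of the quadratic character modulo 3.\<close>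
definition mod3_sign :: "int \<Rightarrow> int" where
  "mod3_sign s = (if s mod 3 = 0 then 0 else if s mod 3 = 1 then -1 else 1)"

lemma pentagonal_has_sum:
  assumes "Im \<tau> > 0"
  shows "((\<lambda>n. of_int (kronecker_m4 n) * e1 (of_int ((3 * n + 2) ^ 2) / 24 * \<tau>)) has_sum - dedekind_eta \<tau>) UNIV"
proof -
  have 3: "Im (3 * \<tau>) > 0" using assms by simp
  have "((\<lambda>n. e1 (\<tau> / 6) * theta_term 0 n (3 * \<tau>) \<tau>) has_sum e1 (\<tau> / 6) * theta_deriv 0 (3 * \<tau>) \<tau>) UNIV"
    by (rule has_sum_cmult_right[OF theta_term_has_sum[OF 3]])
  also have "(\<lambda>n. e1 (\<tau> / 6) * theta_term 0 n (3 * \<tau>) \<tau>) =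
      (\<lambda>n. of_int (kronecker_m4 n) * e1 (of_int ((3 * n + 2) ^ 2) / 24 * \<tau>))"
  proof
    fix n
    have "\<tau> / 6 + (of_int n ^ 2 / 8 * (3 * \<tau>) + of_int n / 2 * \<tau>) = of_int ((3 * n + 2) ^ 2) / 24 * \<tau>"
      by (simp add: power2_eq_square field_simps)
    then have "e1 (\<tau> / 6) * e1 (of_int n ^ 2 / 8 * (3 * \<tau>) + of_int n / 2 * \<tau>) = e1 (of_int ((3 * n + 2) ^ 2) / 24 * \<tau>)"
      by (simp only: flip: e1_add)
    then show "e1 (\<tau> / 6) * theta_term 0 n (3 * \<tau>) \<tau> = of_int (kronecker_m4 n) * e1 (of_int ((3 * n + 2) ^ 2) / 24 * \<tau>)"
      unfolding theta_term_0_eq by (simp only: mult_ac)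
  qed
  also have "e1 (\<tau> / 6) * theta_deriv 0 (3 * \<tau>) \<tau> = - dedekind_eta \<tau>"
    by (simp add: dedekind_eta_pentagonal[OF assms] jacobi_theta_eq)
  finally show ?thesis .
qed

lemma has_sum_reindex_int:
  fixes f :: "int \<Rightarrow> complex"
  assumes "(f has_sum S) UNIV" "\<And>n. h (h' n) = n" "\<And>n. h' (h n) = n" "\<And>n. g n = f (h n)"
  shows "(g has_sum S) UNIV"
  using assms by (subst has_sum_reindex_bij_witness[of UNIV h' h UNIV f]) auto

lemma mod3_sign_has_sum:
  assumes "Im \<tau> > 0"
  shows "((\<lambda>n. of_int (kronecker_m4 n) * e1 (of_int ((2 * s - 3 * n) ^ 2) / 24 * \<tau>)) has_sum
     (if even s then 1 else -1) * of_int (mod3_sign s) * dedekind_eta \<tau>) UNIV"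
proof -
  define f where "f n = of_int (kronecker_m4 n) * e1 (of_int ((3 * n + 2) ^ 2) / 24 * \<tau>)" for n
  have f: "(f has_sum - dedekind_eta \<tau>) UNIV"
    using pentagonal_has_sum[OF assms] unfolding f_def .
  have refl: "kronecker_m4 (2 * u - n) = (if even u then -1 else 1) * kronecker_m4 n" for u n
    using kronecker_m4_shift[of "- n" u] by (simp add: kronecker_m4_uminus)
  have "s mod 3 = 0 \<or> s mod 3 = 1 \<or> s mod 3 = 2" by presburger
  then show ?thesis
  proof (elim disjE)
    assume s: "s mod 3 = 0"
    then obtain u where u: "s = 3 * u" by (metis mod_0_imp_dvd dvdE)
    \<comment> \<open>Here the series is theta at \<open>3 \<tau>\<close> and \<open>z = 0\<close>, which vanishes as theta is odd.\<close>
    have 3: "Im (3 * \<tau>) > 0" using assms by simp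
    have "theta_deriv 0 (3 * \<tau>) 0 = 0" using jacobi_theta_odd[of "3 * \<tau>" 0] by (simp add: jacobi_theta_eq)
    then have "((\<lambda>n. (if even u then -1 else 1) * theta_term 0 n (3 * \<tau>) 0) has_sum 0) UNIV"
      using has_sum_cmult_right[OF theta_term_has_sum[OF 3, of 0 0], of "if even u then -1 else 1"] by simp
    then have "((\<lambda>n. of_int (kronecker_m4 n) * e1 (of_int ((2 * s - 3 * n) ^ 2) / 24 * \<tau>)) has_sum 0) UNIV"
    proof (rule has_sum_reindex_int[where h = "\<lambda>n. 2 * u - n" and h' = "\<lambda>n. 2 * u - n"])
      fix n
      have eq: "of_int ((2 * s - 3 * n) ^ 2) / 24 * \<tau> = of_int (2 * u - n) ^ 2 / 8 * (3 * \<tau>)"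
        by (simp add: u power2_eq_square field_simps)
      show "of_int (kronecker_m4 n) * e1 (of_int ((2 * s - 3 * n) ^ 2) / 24 * \<tau>) =
          (if even u then -1 else 1) * theta_term 0 (2 * u - n) (3 * \<tau>) 0"
        unfolding theta_term_0_eq eq refl by simp
    qed auto
    then show ?thesis using s by (simp add: mod3_sign_def)
  next
    assume s: "s mod 3 = 1"
    \<comment> \<open>\<open>2 s - 3 n = 3 (2 u - n) + 2\<close> brings the series to pentagonal form.\<close>
    define u where "u = s div 3"
    have u: "s = 3 * u + 1" using s by (simp add: u_def) presburger
    have "((\<lambda>n. (if even u then -1 else 1) * f n) has_sum (if even u then -1 else 1) * - dedekind_eta \<tau>) UNIV"
      by (rule has_sum_cmult_right[OF f])
    then have "((\<lambda>n. of_int (kronecker_m4 n) * e1 (of_int ((2 * s - 3 * n) ^ 2) / 24 * \<tau>)) has_sum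
        (if even u then -1 else 1) * - dedekind_eta \<tau>) UNIV"
    proof (rule has_sum_reindex_int[where h = "\<lambda>n. 2 * u - n" and h' = "\<lambda>n. 2 * u - n"])
      fix n
      have eq: "2 * s - 3 * n = 3 * (2 * u - n) + 2" by (simp add: u)
      show "of_int (kronecker_m4 n) * e1 (of_int ((2 * s - 3 * n) ^ 2) / 24 * \<tau>) =
          (if even u then -1 else 1) * f (2 * u - n)"
        unfolding f_def refl eq by simp
    qed auto
    then show ?thesis using s by (cases "even u") (simp_all add: mod3_sign_def u)
  next
    assume s: "s mod 3 = 2"
    \<comment> \<open>\<open>2 s - 3 n = - (3 (n - 2 u) + 2)\<close>, and only the square matters.\<close>
    define u where "u = s div 3 + 1"
    have u: "s = 3 * u - 1" using s by (simp add: u_def) presburger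
    have "((\<lambda>n. (if even u then 1 else -1) * f n) has_sum (if even u then 1 else -1) * - dedekind_eta \<tau>) UNIV"
      by (rule has_sum_cmult_right[OF f])
    then have "((\<lambda>n. of_int (kronecker_m4 n) * e1 (of_int ((2 * s - 3 * n) ^ 2) / 24 * \<tau>)) has_sum
        (if even u then 1 else -1) * - dedekind_eta \<tau>) UNIV"
    proof (rule has_sum_reindex_int[where h = "\<lambda>n. n - 2 * u" and h' = "\<lambda>n. n + 2 * u"])
      fix n
      have "2 * s - 3 * n = - (3 * (n - 2 * u) + 2)" by (simp add: u)
      then have eq: "(2 * s - 3 * n) ^ 2 = (3 * (n - 2 * u) + 2) ^ 2" by (metis power2_minus)
      show "of_int (kronecker_m4 n) * e1 (of_int ((2 * s - 3 * n) ^ 2) / 24 * \<tau>) =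
          (if even u then 1 else -1) * f (n - 2 * u)"
        using kronecker_m4_shift[of n "- u"] unfolding f_def eq by simp
    qed auto
    then show ?thesis using s by (cases "even u") (simp_all add: mod3_sign_def u)
  qed
qed

text \<open>The Macdonald identity of type \<open>A\<^sub>2\<close>.\<close>
theorem theta_quark_has_sum:
  assumes \<tau>: "Im \<tau> > 0"
  shows "((\<lambda>(r, s). of_int (mod3_sign (r + s)) *
      e1 (of_int (r ^ 2 - r * s + s ^ 2) / 3 * \<tau> + of_int r * x + of_int s * y)) has_sum
    jacobi_theta \<tau> x * jacobi_theta \<tau> y * jacobi_theta \<tau> (x + y) / dedekind_eta \<tau>) UNIV"
proof -
  define F where "F = (\<lambda>((k, l), n). theta_term 0 k \<tau> x * theta_term 0 l \<tau> y * theta_term 0 n \<tau> (x + y))"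
  \<comment> \<open>The range of \<open>\<phi>\<close> contains all triples of odd integers, and theta terms at even integers vanish.\<close>
  define \<phi> :: "(int \<times> int) \<times> int \<Rightarrow> (int \<times> int) \<times> int" where "\<phi> = (\<lambda>((r, s), n). ((2 * r - n, 2 * s - n), n))"
  define g where "g = (\<lambda>(r, s). of_int (mod3_sign (r + s)) *
      e1 (of_int (r ^ 2 - r * s + s ^ 2) / 3 * \<tau> + of_int r * x + of_int s * y))"
  define P where "P = jacobi_theta \<tau> x * jacobi_theta \<tau> y * jacobi_theta \<tau> (x + y)"
  have "((\<lambda>(p, n). (case p of (k, l) \<Rightarrow> theta_term 0 k \<tau> x * theta_term 0 l \<tau> y) * theta_term 0 n \<tau> (x + y))
      has_sum P) ((UNIV \<times> UNIV) \<times> UNIV)"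
    unfolding P_def jacobi_theta_eq by (intro has_sum_product theta_term_has_sum \<tau>)
  then have "(F has_sum P) UNIV"
    by (simp add: F_def case_prod_unfold)
  moreover have "F p = 0" if "p \<notin> range \<phi>" for p
  proof -
    obtain k l n where p: "p = ((k, l), n)" by (metis surj_pair)
    have "even k \<or> even l \<or> even n"
    proof (rule ccontr)
      assume "\<not> ?thesis"
      then have "p = \<phi> (((k + n) div 2, (l + n) div 2), n)" by (simp add: p \<phi>_def)
      then show False using that by blast
    qed
    then show ?thesis by (auto simp: p F_def theta_term_def kronecker_m4_even)
  qed
  ultimately have "(F has_sum P) (range \<phi>)"
    by (subst has_sum_cong_neutral[where T = UNIV and g = F]) auto
  moreover have "inj \<phi>" by (auto simp: inj_on_def \<phi>_def)
  ultimately have sum1: "((\<lambda>p. F (\<phi> p)) has_sum P) (UNIV \<times> UNIV)"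
    by (simp add: has_sum_reindex o_def)
  have inner: "((\<lambda>n. F (\<phi> (p, n))) has_sum g p * dedekind_eta \<tau>) UNIV" for p
  proof -
    obtain r s where p: "p = (r, s)" by (cases p)
    define e where "e = e1 (of_int (r ^ 2 - r * s + s ^ 2) / 3 * \<tau> + of_int r * x + of_int s * y)"
    define \<sigma> :: complex where "\<sigma> = (if even (r + s) then 1 else -1)"
    \<comment> \<open>The sign of \<open>r + s\<close> enters once from the characters and once from the series over \<open>n\<close>.\<close>
    have sq: "\<sigma> * \<sigma> = 1" by (simp add: \<sigma>_def)
    have terms: "F (\<phi> (p, n)) = \<sigma> * e * (of_int (kronecker_m4 n) * e1 (of_int ((2 * (r + s) - 3 * n) ^ 2) / 24 * \<tau>))" for n
    proof -
      have refl: "kronecker_m4 (2 * u - n) = (if even u then -1 else 1) * kronecker_m4 n" for u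
        using kronecker_m4_shift[of "- n" u] by (simp add: kronecker_m4_uminus)
      have cube: "kronecker_m4 n * kronecker_m4 n * kronecker_m4 n = kronecker_m4 n"
        by (simp add: kronecker_m4_def)
      have "kronecker_m4 (2 * r - n) * kronecker_m4 (2 * s - n) * kronecker_m4 n =
          (if even (r + s) then 1 else -1) * kronecker_m4 n"
        unfolding refl using cube by auto
      from arg_cong[OF this, of "of_int :: int \<Rightarrow> complex"] have sign: "of_int (kronecker_m4 (2 * r - n)) * of_int (kronecker_m4 (2 * s - n)) * of_int (kronecker_m4 n) =
          \<sigma> * of_int (kronecker_m4 n)"
        by (cases "even (r + s)")
           (simp_all only: \<sigma>_def if_True if_False of_int_mult of_int_1 of_int_minus not_True_eq_False)
      have "(of_int (2 * r - n) ^ 2 / 8 * \<tau> + of_int (2 * r - n) / 2 * x) +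
          (of_int (2 * s - n) ^ 2 / 8 * \<tau> + of_int (2 * s - n) / 2 * y) +
          (of_int n ^ 2 / 8 * \<tau> + of_int n / 2 * (x + y)) =
          (of_int (r ^ 2 - r * s + s ^ 2) / 3 * \<tau> + of_int r * x + of_int s * y) +
          of_int ((2 * (r + s) - 3 * n) ^ 2) / 24 * \<tau>"
        by (simp add: power2_eq_square field_simps)
      then have expo: "e1 (of_int (2 * r - n) ^ 2 / 8 * \<tau> + of_int (2 * r - n) / 2 * x) *
          e1 (of_int (2 * s - n) ^ 2 / 8 * \<tau> + of_int (2 * s - n) / 2 * y) *
          e1 (of_int n ^ 2 / 8 * \<tau> + of_int n / 2 * (x + y)) =
          e * e1 (of_int ((2 * (r + s) - 3 * n) ^ 2) / 24 * \<tau>)"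
        unfolding e_def by (simp only: flip: e1_add)
      have "F (\<phi> (p, n)) =
        (of_int (kronecker_m4 (2 * r - n)) * of_int (kronecker_m4 (2 * s - n)) * of_int (kronecker_m4 n)) *
        (e1 (of_int (2 * r - n) ^ 2 / 8 * \<tau> + of_int (2 * r - n) / 2 * x) *
          e1 (of_int (2 * s - n) ^ 2 / 8 * \<tau> + of_int (2 * s - n) / 2 * y) *
          e1 (of_int n ^ 2 / 8 * \<tau> + of_int n / 2 * (x + y)))"
        unfolding F_def \<phi>_def p case_prod_conv theta_term_0_eq by (simp only: mult_ac)
      then show ?thesis unfolding sign expo by (simp only: mult_ac)
    qed
    have "((\<lambda>n. \<sigma> * e * (of_int (kronecker_m4 n) * e1 (of_int ((2 * (r + s) - 3 * n) ^ 2) / 24 * \<tau>))) has_sum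
        \<sigma> * e * (\<sigma> * of_int (mod3_sign (r + s)) * dedekind_eta \<tau>)) UNIV"
      unfolding \<sigma>_def by (rule has_sum_cmult_right[OF mod3_sign_has_sum[OF \<tau>]])
    moreover have "\<sigma> * e * (\<sigma> * of_int (mod3_sign (r + s)) * dedekind_eta \<tau>) =
        (\<sigma> * \<sigma>) * (of_int (mod3_sign (r + s)) * e * dedekind_eta \<tau>)"
      by (simp only: mult_ac)
    moreover have "g p = of_int (mod3_sign (r + s)) * e" by (simp add: g_def p e_def)
    ultimately show ?thesis
      unfolding terms by (simp only: sq mult_1_left)
  qed
  have "((\<lambda>p. g p * dedekind_eta \<tau>) has_sum P) UNIV"
    by (rule has_sum_SigmaD[OF sum1 inner])
  then have "((\<lambda>p. g p * dedekind_eta \<tau> * inverse (dedekind_eta \<tau>)) has_sum P * inverse (dedekind_eta \<tau>)) UNIV"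
    by (rule has_sum_cmult_left)
  then show ?thesis
    using dedekind_eta_nonzero[OF \<tau>] by (simp add: g_def P_def field_simps)
qed

text \<open>The pairs \<open>(r, s)\<close> whose term in the expansion does not vanish.\<close>
definition quark_index_set :: "(int \<times> int) set" where
  "quark_index_set = {(r, s). \<not> 3 dvd r + s}"

text \<open>The exponents of \<open>q\<close> and of \<open>e1 z\<close> in the term \<open>(r, s)\<close>, after the substitution
  \<open>x = a z\<close>, \<open>y = b z\<close>.\<close>
definition quark_exponent :: "nat \<Rightarrow> nat \<Rightarrow> int \<times> int \<Rightarrow> rat \<times> int" where
  "quark_exponent a b = (\<lambda>(r, s). (of_int (r ^ 2 - r * s + s ^ 2) / 3, int a * r + int b * s))"

text \<open>The Fourier coefficient collects the signs of all terms with given exponents. There are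
  finitely many of them, as the quadratic form is positive definite.\<close>
definition quark_coeff :: "nat \<Rightarrow> nat \<Rightarrow> rat \<Rightarrow> int \<Rightarrow> complex" where
  "quark_coeff a b n l =
     infsum (\<lambda>(r, s). of_int (mod3_sign (r + s))) {p \<in> quark_index_set. quark_exponent a b p = (n, l)}"

lemma quark_discriminant:
  fixes a b :: nat and r s :: int
  shows "4 * (of_int (r ^ 2 - r * s + s ^ 2) / 3) * of_nat (a ^ 2 + a * b + b ^ 2) - of_int (int a * r + int b * s) ^ 2
    = (of_int ((int a + 2 * int b) * r - (2 * int a + int b) * s) ^ 2 / 3 :: rat)"
  by (simp add: power2_eq_square field_simps)

lemma quark_exponent_in:
  assumes "p \<in> quark_index_set"
  shows "quark_exponent a b p \<in> jacobi_exponents (a ^ 2 + a * b + b ^ 2) 8"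
proof -
  obtain r s where p: "p = (r, s)" and rs: "\<not> 3 dvd r + s"
    using assms by (auto simp: quark_index_set_def)
  define N where "N = r ^ 2 - r * s + s ^ 2"
  have "4 * N = (2 * r - s) ^ 2 + 3 * s ^ 2"
    by (simp add: N_def power2_eq_square algebra_simps)
  moreover have "(2 * r - s) ^ 2 + 3 * s ^ 2 \<ge> 0" by simp
  ultimately have "N \<ge> 0" by linarith
  have "(r + s) mod 3 = 1 \<or> (r + s) mod 3 = 2" using rs by presburger
  then obtain k where "r + s = 3 * k + 1 \<or> r + s = 3 * k + 2"
    by (metis mult_div_mod_eq)
  then have "3 dvd (r + s) ^ 2 - 1"
  proof
    assume "r + s = 3 * k + 1"
    then have "(r + s) ^ 2 - 1 = 3 * (3 * k ^ 2 + 2 * k)" by (simp add: power2_eq_square algebra_simps)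
    then show ?thesis by simp
  next
    assume "r + s = 3 * k + 2"
    then have "(r + s) ^ 2 - 1 = 3 * (3 * k ^ 2 + 4 * k + 1)" by (simp add: power2_eq_square algebra_simps)
    then show ?thesis by simp
  qed
  then obtain m where "(r + s) ^ 2 - 1 = 3 * m" by blast
  then have N: "N = 3 * (m - r * s) + 1" by (simp add: N_def power2_eq_square algebra_simps)
  have "of_int N / 3 - of_int 8 / 24 = (of_int (m - r * s) :: rat)" unfolding N by (simp add: field_simps)
  then have "of_int N / 3 - of_int 8 / 24 \<in> (\<int> :: rat set)" by (metis Ints_of_int)
  moreover have "4 * (of_int N / 3) * of_nat (a ^ 2 + a * b + b ^ 2) - of_int (int a * r + int b * s) ^ 2 \<ge> (0 :: rat)"
    unfolding N_def quark_discriminant by simp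
  moreover have "(of_int N / 3 :: rat) \<ge> 0" using \<open>N \<ge> 0\<close> by simp
  ultimately show ?thesis
    unfolding jacobi_exponents_def quark_exponent_def p case_prod_conv mem_Collect_eq N_def[symmetric] by blast
qed

lemma theta_quark_fourier_expansion:
  "jacobi_fourier_expansion (a ^ 2 + a * b + b ^ 2) 8 (theta_quark a b) (quark_coeff a b)"
  unfolding jacobi_fourier_expansion_def
proof (intro ballI allI)
  fix \<tau> z assume "\<tau> \<in> upper_half_plane"
  then have \<tau>: "Im \<tau> > 0" by (simp add: upper_half_plane_def)
  define f where "f = (\<lambda>(r, s). of_int (mod3_sign (r + s)) *
      e1 (of_int (r ^ 2 - r * s + s ^ 2) / 3 * \<tau> + of_int r * (of_nat a * z) + of_int s * (of_nat b * z)))"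
  have "(f has_sum theta_quark a b \<tau> z) UNIV"
    using theta_quark_has_sum[OF \<tau>, of "of_nat a * z" "of_nat b * z"]
    unfolding f_def theta_quark_def by (simp add: ring_distribs)
  then have "(f has_sum theta_quark a b \<tau> z) quark_index_set"
    by (subst has_sum_cong_neutral[where T = UNIV and g = f])
       (auto simp: quark_index_set_def f_def mod3_sign_def mod_0_imp_dvd)
  then have fibers: "((\<lambda>e. infsum f {p \<in> quark_index_set. quark_exponent a b p = e}) has_sum theta_quark a b \<tau> z)
      (jacobi_exponents (a ^ 2 + a * b + b ^ 2) 8)"
    by (rule has_sum_fibers) (rule quark_exponent_in)
  have coeff: "infsum f {p \<in> quark_index_set. quark_exponent a b p = (n, l)} =
      quark_coeff a b n l * exp (2 * of_real pi * \<i> * (of_rat n * \<tau> + of_int l * z))" for n l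
  proof -
    have "infsum f {p \<in> quark_index_set. quark_exponent a b p = (n, l)} =
        infsum (\<lambda>p. (case p of (r, s) \<Rightarrow> of_int (mod3_sign (r + s))) * e1 (of_rat n * \<tau> + of_int l * z))
          {p \<in> quark_index_set. quark_exponent a b p = (n, l)}"
    proof (rule infsum_cong)
      fix p assume "p \<in> {p \<in> quark_index_set. quark_exponent a b p = (n, l)}"
      then obtain r s where p: "p = (r, s)" and n: "n = of_int (r ^ 2 - r * s + s ^ 2) / 3"
        and l: "l = int a * r + int b * s"
        by (cases p) (auto simp: quark_exponent_def)
      have n': "of_rat n = (of_int (r ^ 2 - r * s + s ^ 2) / 3 :: complex)"
        unfolding n of_rat_divide of_rat_of_int_eq by simp
      have "of_int (r ^ 2 - r * s + s ^ 2) / 3 * \<tau> + of_int r * (of_nat a * z) + of_int s * (of_nat b * z)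
          = of_rat n * \<tau> + of_int l * z"
        unfolding n' by (simp add: l algebra_simps)
      then show "f p = (case p of (r, s) \<Rightarrow> of_int (mod3_sign (r + s))) * e1 (of_rat n * \<tau> + of_int l * z)"
        by (simp only: f_def p case_prod_conv)
    qed
    also have "\<dots> = quark_coeff a b n l * e1 (of_rat n * \<tau> + of_int l * z)"
      unfolding quark_coeff_def by (rule infsum_cmult_left')
    finally show ?thesis by (simp add: e1_def)
  qed
  have "(\<lambda>e. infsum f {p \<in> quark_index_set. quark_exponent a b p = e}) =
      (\<lambda>(n, r). quark_coeff a b n r * exp (2 * of_real pi * \<i> * (of_rat n * \<tau> + of_int r * z)))"
  proof
    fix e :: "rat \<times> int"
    obtain n l where "e = (n, l)" by (cases e)
    then show "infsum f {p \<in> quark_index_set. quark_exponent a b p = e} =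
        (case e of (n, r) \<Rightarrow> quark_coeff a b n r * exp (2 * of_real pi * \<i> * (of_rat n * \<tau> + of_int r * z)))"
      by (simp only: coeff case_prod_conv)
  qed
  with fibers show "((\<lambda>(n, r). quark_coeff a b n r * exp (2 * of_real pi * \<i> * (of_rat n * \<tau> + of_int r * z)))
      has_sum theta_quark a b \<tau> z) (jacobi_exponents (a ^ 2 + a * b + b ^ 2) 8)"
    by (simp only:)
qed

lemma quark_coeff_cuspidal:
  assumes ab: "\<not> [a = b] (mod 3)" and "quark_coeff a b n l \<noteq> 0"
  shows "4 * n * of_nat (a ^ 2 + a * b + b ^ 2) - of_int l ^ 2 > 0"
proof -
  have "{p \<in> quark_index_set. quark_exponent a b p = (n, l)} \<noteq> {}"
    using assms(2) unfolding quark_coeff_def by (metis infsum_empty)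
  then obtain r s where rs: "\<not> 3 dvd r + s" and n: "n = of_int (r ^ 2 - r * s + s ^ 2) / 3"
    and l: "l = int a * r + int b * s"
    by (auto simp: quark_exponent_def quark_index_set_def)
  define D where "D = (int a + 2 * int b) * r - (2 * int a + int b) * s"
  have "D \<noteq> 0"
  proof
    assume "D = 0"
    moreover have "(int a - int b) * (r + s) = D + 3 * (int a * s - int b * r)"
      by (simp add: D_def algebra_simps)
    ultimately have "3 dvd (int a - int b) * (r + s)" by simp
    then have "3 dvd int a - int b"
      using rs prime_dvd_multD[of "3 :: int"] by auto
    then have "[int a = int b] (mod 3)" by (simp add: cong_iff_dvd_diff)
    then have "[a = b] (mod 3)" using cong_int_iff[of a b 3] by simp
    then show False using ab by blast
  qed
  then have "(of_int D ^ 2 / 3 :: rat) > 0" by simp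
  then show ?thesis unfolding n l quark_discriminant D_def .
qed

section \<open>Holomorphy and transformation laws of the theta quark\<close>

lemma holomorphic2_on_mult:
  assumes "holomorphic2_on f S" "holomorphic2_on g S"
  shows "holomorphic2_on (\<lambda>\<tau> z. f \<tau> z * g \<tau> z) S"
  unfolding holomorphic2_on_def
proof
  fix p assume p: "p \<in> S"
  obtain u v where f: "((\<lambda>(\<tau>, z). f \<tau> z) has_derivative (\<lambda>(h, k). u * h + v * k)) (at p within S)"
    using assms(1) p unfolding holomorphic2_on_def by blast
  obtain u' v' where g: "((\<lambda>(\<tau>, z). g \<tau> z) has_derivative (\<lambda>(h, k). u' * h + v' * k)) (at p within S)"
    using assms(2) p unfolding holomorphic2_on_def by blast
  obtain \<tau> z where pp: "p = (\<tau>, z)" by (cases p)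
  have "((\<lambda>(\<tau>, z). f \<tau> z * g \<tau> z) has_derivative
      (\<lambda>(h, k). (f \<tau> z * u' + u * g \<tau> z) * h + (f \<tau> z * v' + v * g \<tau> z) * k)) (at p within S)"
    using has_derivative_mult[OF f g] unfolding pp
    by (simp add: case_prod_unfold algebra_simps)
  then show "\<exists>u v. ((\<lambda>(\<tau>, z). f \<tau> z * g \<tau> z) has_derivative (\<lambda>(h, k). u * h + v * k)) (at p within S)"
    by blast
qed

lemma holomorphic2_on_fst:
  assumes "\<And>\<tau> z. (\<tau>, z) \<in> S \<Longrightarrow> \<exists>D. (f has_field_derivative D) (at \<tau>)"
  shows "holomorphic2_on (\<lambda>\<tau> z. f \<tau>) S"
  unfolding holomorphic2_on_def
proof
  fix p assume p: "p \<in> S"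
  obtain \<tau> z where pp: "p = (\<tau>, z)" by (cases p)
  obtain D where D: "(f has_derivative (\<lambda>h. D * h)) (at \<tau>)"
    using assms p unfolding pp has_field_derivative_def by blast
  have "((\<lambda>p. f (fst p)) has_derivative (\<lambda>h. D * fst h)) (at p within S)"
    by (rule has_derivative_compose[where f = fst and g = f])
       (use D in \<open>auto intro!: derivative_eq_intros simp: pp\<close>)
  then have "((\<lambda>(\<tau>, z). f \<tau>) has_derivative (\<lambda>(h, k). D * h + 0 * k)) (at p within S)"
    by (simp add: case_prod_unfold)
  then show "\<exists>u v. ((\<lambda>(\<tau>, z). f \<tau>) has_derivative (\<lambda>(h, k). u * h + v * k)) (at p within S)"
    by blast
qed

lemma holomorphic2_on_jacobi_theta:
  "holomorphic2_on (\<lambda>\<tau> z. jacobi_theta \<tau> (c * z)) (upper_half_plane \<times> UNIV)"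
  unfolding holomorphic2_on_def
proof
  fix p assume "p \<in> upper_half_plane \<times> (UNIV :: complex set)"
  then obtain \<tau> z where p: "p = (\<tau>, z)" and \<tau>: "Im \<tau> > 0"
    by (auto simp: upper_half_plane_def)
  define u where "u = theta_deriv (0 + 2) \<tau> (c * z) / (4 * of_real pi * \<i>)"
  define v where "v = theta_deriv (0 + 1) \<tau> (c * z)"
  have d: "((\<lambda>(\<tau>, z). theta_deriv 0 \<tau> z) has_derivative (\<lambda>(h, k). u * h + v * k)) (at (fst p, c * snd p))"
    using theta_deriv_has_derivative[OF \<tau>, of 0 "c * z"] by (simp add: p u_def v_def)
  have "((\<lambda>p. (\<lambda>(\<tau>, z). theta_deriv 0 \<tau> z) (fst p, c * snd p)) has_derivative
      (\<lambda>h. (\<lambda>(h, k). u * h + v * k) (fst h, c * snd h))) (at p within upper_half_plane \<times> UNIV)"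
    by (rule has_derivative_compose[where f = "\<lambda>p. (fst p, c * snd p)", OF _ d])
       (auto intro!: derivative_eq_intros)
  then have "((\<lambda>(\<tau>, z). jacobi_theta \<tau> (c * z)) has_derivative (\<lambda>(h, k). u * h + (v * c) * k))
      (at p within upper_half_plane \<times> UNIV)"
    by (simp add: case_prod_unfold jacobi_theta_eq mult.assoc)
  then show "\<exists>u v. ((\<lambda>(\<tau>, z). jacobi_theta \<tau> (c * z)) has_derivative (\<lambda>(h, k). u * h + v * k))
      (at p within upper_half_plane \<times> UNIV)" by blast
qed

lemma theta_quark_holomorphic: "holomorphic2_on (theta_quark a b) (upper_half_plane \<times> UNIV)"
proof -
  have "\<exists>D. ((\<lambda>\<tau>. inverse (dedekind_eta \<tau>)) has_field_derivative D) (at \<tau>)" if "\<tau> \<in> upper_half_plane" for \<tau>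
    using that dedekind_eta_DERIV[of \<tau>] dedekind_eta_nonzero[of \<tau>] DERIV_inverse_fun
    unfolding upper_half_plane_def by blast
  then have "holomorphic2_on (\<lambda>\<tau> z. jacobi_theta \<tau> (of_nat a * z) * jacobi_theta \<tau> (of_nat b * z) *
      jacobi_theta \<tau> (of_nat (a + b) * z) * inverse (dedekind_eta \<tau>)) (upper_half_plane \<times> UNIV)"
    by (intro holomorphic2_on_mult holomorphic2_on_jacobi_theta holomorphic2_on_fst) auto
  then show ?thesis
    by (simp add: theta_quark_def[abs_def] divide_inverse)
qed

lemma theta_quark_elliptic: "jacobi_elliptic (a ^ 2 + a * b + b ^ 2) (theta_quark a b)"
  unfolding jacobi_elliptic_def
proof (intro allI ballI)
  fix x y :: int and \<tau> z assume "\<tau> \<in> upper_half_plane"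
  then have \<tau>: "Im \<tau> > 0" by (simp add: upper_half_plane_def)
  define w where "w = z + of_int x * \<tau> + of_int y"
  define E where "E k = - (of_int (k * x) ^ 2 * \<tau> + 2 * of_int (k * x) * (of_int k * z) + of_int (k * x) + of_int (k * y)) / 2" for k :: int
  have shift: "jacobi_theta \<tau> (of_int k * w) = e1 (E k) * jacobi_theta \<tau> (of_int k * z)" for k :: int
  proof -
    have "of_int k * w = of_int k * z + of_int (k * x) * \<tau> + of_int (k * y)"
      by (simp add: w_def algebra_simps)
    then show ?thesis by (simp only: jacobi_theta_shift[OF \<tau>] E_def)
  qed
  define N where "N = of_nat (a ^ 2 + a * b + b ^ 2) * (of_int x ^ 2 * \<tau> + 2 * of_int x * z)"
  have "E (int a) + E (int b) + E (int (a + b)) = - N + of_int (- (int a + int b) * (x + y))"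
    unfolding E_def N_def by (simp add: power2_eq_square field_simps)
  then have e: "e1 (E (int a)) * e1 (E (int b)) * e1 (E (int (a + b))) = e1 (- N)"
    by (simp only: e1_add_of_int flip: e1_add)
  have "theta_quark a b \<tau> w = e1 (E (int a)) * e1 (E (int b)) * e1 (E (int (a + b))) * theta_quark a b \<tau> z"
    unfolding theta_quark_def using shift[of "int a"] shift[of "int b"] shift[of "int (a + b)"]
    by (simp add: mult_ac)
  also have "e1 (E (int a)) * e1 (E (int b)) * e1 (E (int (a + b))) =
      exp (- 2 * of_real pi * \<i> * of_nat (a ^ 2 + a * b + b ^ 2) * (of_int x ^ 2 * \<tau> + 2 * of_int x * z))"
    unfolding e unfolding e1_def N_def by (rule arg_cong[where f = exp]) (simp only: mult_ac mult_minus_left mult_minus_right)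
  finally show "theta_quark a b \<tau> (z + of_int x * \<tau> + of_int y) =
      exp (- 2 * of_real pi * \<i> * of_nat (a ^ 2 + a * b + b ^ 2) * (of_int x ^ 2 * \<tau> + 2 * of_int x * z)) * theta_quark a b \<tau> z"
    unfolding w_def .
qed

lemma eta_multiplier_transform:
  assumes "A \<in> SL2Z" "Im \<tau> > 0"
  shows "dedekind_eta (moebius_action A \<tau>) = eta_multiplier A * csqrt (moebius_denom A \<tau>) * dedekind_eta \<tau>"
proof -
  interpret sl2_action "A $ 1 $ 1" "A $ 1 $ 2" "A $ 2 $ 1" "A $ 2 $ 2"
    by standard (use assms in \<open>simp add: SL2Z_def det_2\<close>)
  have j: "j = moebius_denom A" and act: "act = moebius_action A"
    by (simp_all add: fun_eq_iff j_def act_def moebius_denom_def moebius_action_def)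
  obtain v where v: "\<And>\<tau>. Im \<tau> > 0 \<Longrightarrow> dedekind_eta (act \<tau>) = v * csqrt (j \<tau>) * dedekind_eta \<tau>"
    using eta_act by blast
  have "eta_multiplier A = v"
    unfolding eta_multiplier_def
  proof (rule the_equality)
    show "\<forall>\<tau>\<in>upper_half_plane. dedekind_eta (moebius_action A \<tau>) = v * csqrt (moebius_denom A \<tau>) * dedekind_eta \<tau>"
      using v by (simp add: upper_half_plane_def j act)
    fix v' assume "\<forall>\<tau>\<in>upper_half_plane. dedekind_eta (moebius_action A \<tau>) = v' * csqrt (moebius_denom A \<tau>) * dedekind_eta \<tau>"
    then have "v' * csqrt (j \<tau>) * dedekind_eta \<tau> = v * csqrt (j \<tau>) * dedekind_eta \<tau>"
      using v[OF assms(2)] assms(2) by (simp add: upper_half_plane_def j act)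
    then show "v' = v"
      using j_nonzero[OF assms(2)] dedekind_eta_nonzero[OF assms(2)] by simp
  qed
  then show ?thesis using v[OF assms(2)] by (simp add: j act)
qed

lemma jacobi_theta_transform:
  assumes "A \<in> SL2Z" "Im \<tau> > 0"
  shows "jacobi_theta (moebius_action A \<tau>) (z / moebius_denom A \<tau>) =
    eta_multiplier A ^ 3 * csqrt (moebius_denom A \<tau>) *
    (e1 (of_int (A $ 2 $ 1) * z ^ 2 / (2 * moebius_denom A \<tau>)) * jacobi_theta \<tau> z)"
proof -
  interpret sl2_action "A $ 1 $ 1" "A $ 1 $ 2" "A $ 2 $ 1" "A $ 2 $ 2"
    by standard (use assms in \<open>simp add: SL2Z_def det_2\<close>)
  have j: "j = moebius_denom A" and act: "act = moebius_action A"
    by (simp_all add: fun_eq_iff j_def act_def moebius_denom_def moebius_action_def)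
  have "mult_factor \<tau> = eta_multiplier A ^ 3 * csqrt (j \<tau>)"
    by (rule mult_factor_eq[OF _ assms(2)])
       (use eta_multiplier_transform[OF assms(1)] in \<open>simp add: j act\<close>)
  then show ?thesis using theta_act[OF assms(2), of z] by (simp add: j act)
qed

lemma theta_quark_modular: "jacobi_modular 1 (a ^ 2 + a * b + b ^ 2) 8 (theta_quark a b)"
  unfolding jacobi_modular_def
proof (intro ballI allI)
  fix A \<tau> z assume A: "A \<in> SL2Z" and "\<tau> \<in> upper_half_plane"
  then have \<tau>: "Im \<tau> > 0" by (simp add: upper_half_plane_def)
  define J where "J = moebius_denom A \<tau>"
  define T where "T = moebius_action A \<tau>"
  define v where "v = eta_multiplier A"
  define g where "g = (of_int (A $ 2 $ 1) :: complex)"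
  interpret sl2_action "A $ 1 $ 1" "A $ 1 $ 2" "A $ 2 $ 1" "A $ 2 $ 2"
    by standard (use A in \<open>simp add: SL2Z_def det_2\<close>)
  have J: "J \<noteq> 0"
    using j_nonzero[OF \<tau>] by (simp add: J_def j_def moebius_denom_def)
  have T: "Im T > 0"
    using Im_act[OF \<tau>] by (simp add: T_def act_def j_def moebius_denom_def moebius_action_def)
  have eta: "dedekind_eta T = v * csqrt J * dedekind_eta \<tau>"
    using eta_multiplier_transform[OF A \<tau>] by (simp add: J_def T_def v_def)
  have nz: "v \<noteq> 0"
    using eta dedekind_eta_nonzero[OF T] by auto
  have theta: "jacobi_theta T (of_nat k * (z / J)) =
      v ^ 3 * csqrt J * (e1 (g * (of_nat k * z) ^ 2 / (2 * J)) * jacobi_theta \<tau> (of_nat k * z))" for k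
    using jacobi_theta_transform[OF A \<tau>, of "of_nat k * z"] by (simp add: J_def T_def v_def g_def)
  define N where "N = of_nat (a ^ 2 + a * b + b ^ 2) * (g * z ^ 2 / J)"
  have e: "e1 (g * (of_nat a * z) ^ 2 / (2 * J)) * e1 (g * (of_nat b * z) ^ 2 / (2 * J)) *
      e1 (g * (of_nat (a + b) * z) ^ 2 / (2 * J)) = e1 N"
    unfolding e1_add[symmetric] N_def
    by (rule arg_cong[where f = e1]) (use J in \<open>simp add: power2_eq_square field_simps\<close>)
  have "theta_quark a b T (z / J) = (v ^ 3 * csqrt J) ^ 3 / (v * csqrt J) *
      (e1 (g * (of_nat a * z) ^ 2 / (2 * J)) * e1 (g * (of_nat b * z) ^ 2 / (2 * J)) *
      e1 (g * (of_nat (a + b) * z) ^ 2 / (2 * J))) * theta_quark a b \<tau> z"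
    unfolding theta_quark_def theta eta by (simp add: power3_eq_cube)
  also have "(v ^ 3 * csqrt J) ^ 3 / (v * csqrt J) = v ^ 8 * csqrt J ^ 2"
    using nz J by (simp add: field_simps power_mult_distrib eval_nat_numeral)
  finally have "theta_quark a b T (z / J) = v ^ 8 * J * e1 N * theta_quark a b \<tau> z"
    unfolding e power2_csqrt .
  then show "theta_quark a b (moebius_action A \<tau>) (z / moebius_denom A \<tau>) =
      eta_multiplier A powi 8 * moebius_denom A \<tau> powi 1 *
      exp (2 * of_real pi * \<i> * of_nat (a ^ 2 + a * b + b ^ 2) * (of_int (A $ 2 $ 1) * z ^ 2 / moebius_denom A \<tau>)) *
      theta_quark a b \<tau> z"
    unfolding J_def[symmetric] T_def[symmetric] v_def[symmetric] g_def[symmetric]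
    by (simp add: e1_def N_def mult_ac)
qed

theorem corollary3p9:
  fixes a b :: nat
  assumes "a > 0" and "b > 0"
  shows "theta_quark a b \<in> jacobi_forms 1 (a^2 + a * b + b^2) 8 \<and>
         (\<not> [a = b] (mod 3) \<longrightarrow> theta_quark a b \<in> jacobi_cusp_forms 1 (a^2 + a * b + b^2) 8)"
proof (intro conjI impI)
  show form: "theta_quark a b \<in> jacobi_forms 1 (a^2 + a * b + b^2) 8"
    unfolding jacobi_forms_def
    using theta_quark_holomorphic theta_quark_modular theta_quark_elliptic theta_quark_fourier_expansion
    by blast
  assume "\<not> [a = b] (mod 3)"
  then show "theta_quark a b \<in> jacobi_cusp_forms 1 (a^2 + a * b + b^2) 8"
    unfolding jacobi_cusp_forms_def
    using form theta_quark_fourier_expansion quark_coeff_cuspidal by blast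
qed

end
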